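(* Let $\Gamma$ be a chordal simplicial complex. Let $S_1,S_2\in\Gamma$ be disjoint faces with $|S_1|=|S_2|=k>1$ and $k$ odd. Suppose that there is no vertex of $\Gamma$ having edges both to (a vertex of) $S_1$ and to (a vertex of) $S_2$. Let $f:S_1\to S_2$ be a bijection, and let $\phi:\Gamma\to\Delta$ be the quotient map obtained by identifying $x$ with $f(x)$ for each $x\in S_1$. Then $$\operatorname{elocr}(\Delta)\le k-1.$$
   Context: A simplicial complex $\Delta$ on a finite vertex set $V(\Delta)$ is a family of subsets of $V(\Delta)$ (called faces) that is closed under taking subsets and contains all singletons. Its edges are its two-element faces. Given an equivalence relation on the vertices of a complex, the quotient complex has the equivalence classes as vertices and the images of faces as faces. Let $I(\Delta)\subseteq\mathbb{R}[x_i:i\in V(\Delta)]$ be the ideal generated by the monomials $\prod_{i\in S}x_i$ with $S\subseteq V(\Delta)$, $S\notin\Delta$, and let $R_d(\Delta)$ be the degree $d$ homogeneous part of $\mathbb{R}[x_i:i\in V(\Delta)]/I(\Delta)$. Elements of $R_d(\Delta)$ are regarded as functions on $\bigcup_{F\in\Delta}\operatorname{span}\{e_i:i\in F\}\subseteq\mathbb{R}^{V(\Delta)}$. Let $\mathcal{P}(\Delta)\subseteq R_2(\Delta)$ be the convex cone of quadratic forms that are nonnegative on this union, and $\Sigma(\Delta)\subseteq\mathcal{P}(\Delta)$ the cone of sums of squares of elements of $R_1(\Delta)$. A nonzero element $x$ of a convex cone $C$ spans an extreme ray if there are no linearly independent $y,z\in C$ with $x=y+z$. The rank of a sum-of-squares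 form is the least $m$ such that it is a sum of $m$ squares of linear forms. For $q\in\mathcal{P}(\Delta)$ the local rank is $\operatorname{locr}(q)=\max_{F\in\Delta}\operatorname{rank}(q|_{\operatorname{span}\{e_i:i\in F\}})$. A complex is chordal if it is the clique complex (faces are the vertex sets of cliques) of a chordal graph, i.e. a graph with no induced cycle of length at least 4. The extreme local rank $\operatorname{elocr}(\Delta)$ is the maximum of $\operatorname{locr}(q)$ over those $q\in\mathcal{P}(\Delta)\setminus\Sigma(\Delta)$ which span an extreme ray of $\mathcal{P}(\Delta)$; it is defined to be $0$ if $\Delta$ is chordal. *)

theory Defs
  imports
    Complex_Main
    "HOL-Library.Poly_Mapping"
    "HOL-Algebra.Embedded_Algebras"
    "HOL-Algebra.QuotRing"
begin

section \<open>Simplicial complexes\<close>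

text \<open>A complex is given by its set of faces. As the faces are subsets of the vertex set and all
  singletons are faces, the vertex set is the union of the faces.\<close>

abbreviation vertices :: "'v set set \<Rightarrow> 'v set"
  where "vertices \<Delta> \<equiv> \<Union>\<Delta>"

definition simplicial_complex :: "'v set set \<Rightarrow> bool"
  where "simplicial_complex \<Delta> \<longleftrightarrow> finite (vertices \<Delta>) \<and> (\<forall>F\<in>\<Delta>. \<forall>G. G \<subseteq> F \<longrightarrow> G \<in> \<Delta>)"

definition edges :: "'v set set \<Rightarrow> 'v set set"
  where "edges \<Delta> = {e \<in> \<Delta>. card e = 2}"

definition quotient_complex :: "'v set set \<Rightarrow> 'v rel \<Rightarrow> 'v set set set"
  where "quotient_complex \<Delta> r = (\<lambda>F. (\<lambda>x. r `` {x}) ` F) ` \<Delta>"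

text \<open>The equivalence relation on the vertices generated by \<open>x \<sim> f x\<close> for \<open>x \<in> S\<close>.\<close>

definition identification :: "'v set set \<Rightarrow> 'v set \<Rightarrow> ('v \<Rightarrow> 'v) \<Rightarrow> 'v rel"
  where "identification \<Delta> S f =
    {(x, y). x \<in> vertices \<Delta> \<and> y \<in> vertices \<Delta> \<and> equivclp (\<lambda>a b. a \<in> S \<and> b = f a) x y}"


section \<open>Chordal complexes\<close>

definition simple_graph :: "'v set \<Rightarrow> 'v set set \<Rightarrow> bool"
  where "simple_graph V E \<longleftrightarrow> finite V \<and> (\<forall>e\<in>E. e \<subseteq> V \<and> card e = 2)"

text \<open>For \<open>n = length c \<ge> 3\<close>: the vertices \<open>c ! 0, \<dots>, c ! (n - 1)\<close> are distinct and the
  subgraph they induce is precisely the cycle through them in this order.\<close>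

definition induced_cycle :: "'v set \<Rightarrow> 'v set set \<Rightarrow> 'v list \<Rightarrow> bool"
  where "induced_cycle V E c \<longleftrightarrow>
    length c \<ge> 3 \<and> distinct c \<and> set c \<subseteq> V \<and>
    (\<forall>i j. i < j \<and> j < length c \<longrightarrow>
      ({c ! i, c ! j} \<in> E \<longleftrightarrow> j = i + 1 \<or> (i = 0 \<and> j = length c - 1)))"

definition chordal_graph :: "'v set \<Rightarrow> 'v set set \<Rightarrow> bool"
  where "chordal_graph V E \<longleftrightarrow>
    simple_graph V E \<and> \<not> (\<exists>c. induced_cycle V E c \<and> length c \<ge> 4)"

definition clique_complex :: "'v set \<Rightarrow> 'v set set \<Rightarrow> 'v set set"
  where "clique_complex V E = {S. S \<subseteq> V \<and> (\<forall>u\<in>S. \<forall>v\<in>S. u \<noteq> v \<longrightarrow> {u, v} \<in> E)}"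

definition chordal_complex :: "'v set set \<Rightarrow> bool"
  where "chordal_complex \<Delta> \<longleftrightarrow> (\<exists>V E. chordal_graph V E \<and> \<Delta> = clique_complex V E)"


section \<open>The Stanley--Reisner ring\<close>

text \<open>A monomial is a finitely supported exponent vector, a polynomial a finitely supported
  family of coefficients.\<close>

type_synonym 'v real_mpoly = "('v \<Rightarrow>\<^sub>0 nat) \<Rightarrow>\<^sub>0 real"

definition Var :: "'v \<Rightarrow> 'v real_mpoly"
  where "Var i = Poly_Mapping.single (Poly_Mapping.single i 1) 1"

definition Const :: "real \<Rightarrow> 'v real_mpoly"
  where "Const c = Poly_Mapping.single 0 c"

definition mpoly_ring :: "'v set \<Rightarrow> 'v real_mpoly ring"
  where "mpoly_ring V =
    \<lparr>carrier = {p. \<forall>m\<in>Poly_Mapping.keys p. Poly_Mapping.keys m \<subseteq> V},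
     mult = (*), one = 1, zero = 0, add = (+)\<rparr>"

definition homogeneous :: "nat \<Rightarrow> 'v real_mpoly \<Rightarrow> bool"
  where "homogeneous d p \<longleftrightarrow>
    (\<forall>m\<in>Poly_Mapping.keys p. (\<Sum>i\<in>Poly_Mapping.keys m. Poly_Mapping.lookup m i) = d)"

definition mpoly_eval :: "'v real_mpoly \<Rightarrow> ('v \<Rightarrow> real) \<Rightarrow> real"
  where "mpoly_eval p x =
    (\<Sum>m\<in>Poly_Mapping.keys p. Poly_Mapping.lookup p m *
      (\<Prod>i\<in>Poly_Mapping.keys m. x i ^ Poly_Mapping.lookup m i))"

definition SR_ideal :: "'v set set \<Rightarrow> 'v real_mpoly set"
  where "SR_ideal \<Delta> =
    genideal (mpoly_ring (vertices \<Delta>)) {\<Prod>i\<in>S. Var i | S. S \<subseteq> vertices \<Delta> \<and> S \<notin> \<Delta>}"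

definition SR_ring :: "'v set set \<Rightarrow> 'v real_mpoly set ring"
  where "SR_ring \<Delta> = mpoly_ring (vertices \<Delta>) Quot SR_ideal \<Delta>"

definition SR_class :: "'v set set \<Rightarrow> 'v real_mpoly \<Rightarrow> 'v real_mpoly set"
  where "SR_class \<Delta> p = SR_ideal \<Delta> +>\<^bsub>mpoly_ring (vertices \<Delta>)\<^esub> p"

definition SR_part :: "nat \<Rightarrow> 'v set set \<Rightarrow> 'v real_mpoly set set"
  where "SR_part d \<Delta> =
    SR_class \<Delta> ` {p \<in> carrier (mpoly_ring (vertices \<Delta>)). homogeneous d p}"

definition SR_scalars :: "'v set set \<Rightarrow> 'v real_mpoly set set"
  where "SR_scalars \<Delta> = SR_class \<Delta> ` range Const"

text \<open>The span of the unit vectors \<open>e\<^sub>i\<close> with \<open>i \<in> F\<close>; points of \<open>\<real>\<^bsup>V\<^esup>\<close> are functions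
  that vanish outside of \<open>V\<close>.\<close>

definition coord_space :: "'v set \<Rightarrow> ('v \<Rightarrow> real) set"
  where "coord_space F = {x. \<forall>i. i \<notin> F \<longrightarrow> x i = 0}"

text \<open>The polynomials in \<open>SR_ideal \<Delta>\<close> vanish on \<open>coord_space F\<close> for \<open>F \<in> \<Delta>\<close>, so the value at
  such a point is the same for all representatives of a residue class.\<close>

definition SR_eval :: "'v real_mpoly set \<Rightarrow> ('v \<Rightarrow> real) \<Rightarrow> real"
  where "SR_eval q x = the_elem ((\<lambda>p. mpoly_eval p x) ` q)"


section \<open>Nonnegative quadratic forms and sums of squares\<close>

definition nonneg_forms :: "'v set set \<Rightarrow> 'v real_mpoly set set"
  where "nonneg_forms \<Delta> =
    {q \<in> SR_part 2 \<Delta>. \<forall>x \<in> (\<Union>F\<in>\<Delta>. coord_space F). SR_eval q x \<ge> 0}"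

definition sos_forms :: "'v set set \<Rightarrow> 'v real_mpoly set set"
  where "sos_forms \<Delta> =
    {\<Oplus>\<^bsub>SR_ring \<Delta>\<^esub>j\<in>{..<m}. l j \<otimes>\<^bsub>SR_ring \<Delta>\<^esub> l j | (m :: nat) l. \<forall>j<m. l j \<in> SR_part 1 \<Delta>}"

definition spans_extreme_ray ::
    "'v set set \<Rightarrow> 'v real_mpoly set set \<Rightarrow> 'v real_mpoly set \<Rightarrow> bool"
  where "spans_extreme_ray \<Delta> C q \<longleftrightarrow>
    q \<in> C \<and> q \<noteq> \<zero>\<^bsub>SR_ring \<Delta>\<^esub> \<and>
    \<not> (\<exists>y\<in>C. \<exists>z\<in>C. ring.independent (SR_ring \<Delta>) (SR_scalars \<Delta>) [y, z] \<and>
         q = y \<oplus>\<^bsub>SR_ring \<Delta>\<^esub> z)"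

text \<open>The rank of a sum-of-squares form \<open>g\<close> on \<open>coord_space F\<close>, where \<open>F\<close> is finite.
  The linear forms on this space are the functions \<open>x \<mapsto> \<Sum>i\<in>F. a i * x i\<close>.\<close>

definition form_rank :: "'v set \<Rightarrow> (('v \<Rightarrow> real) \<Rightarrow> real) \<Rightarrow> nat"
  where "form_rank F g =
    (LEAST m. \<exists>a :: nat \<Rightarrow> 'v \<Rightarrow> real.
      \<forall>x\<in>coord_space F. g x = (\<Sum>j<m. (\<Sum>i\<in>F. a j i * x i)\<^sup>2))"

definition locr :: "'v set set \<Rightarrow> 'v real_mpoly set \<Rightarrow> nat"
  where "locr \<Delta> q = Max ((\<lambda>F. form_rank F (SR_eval q)) ` \<Delta>)"

text \<open>On \<open>nat\<close>, \<open>Sup\<close> is the maximum of a nonempty finite set, and \<open>Sup {} = 0\<close>.\<close>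

definition elocr :: "'v set set \<Rightarrow> nat"
  where "elocr \<Delta> =
    (if chordal_complex \<Delta> then 0
     else Sup (locr \<Delta> ` {q \<in> nonneg_forms \<Delta> - sos_forms \<Delta>.
                          spans_extreme_ray \<Delta> (nonneg_forms \<Delta>) q}))"

end

theory Submission
  imports
    Defs
    "HOL-Analysis.Convex"
    "Jordan_Normal_Form.Spectral_Radius"
begin

text \<open>Every extreme nonnegative form on the quotient complex has local rank at most \<open>2\<close>, and
  \<open>2 \<le> k - 1\<close> because \<open>k\<close> is odd and greater than \<open>1\<close>.  Pulled back to the chordal complex, the form
  is a partial matrix that is positive semidefinite on all cliques, so it is the Gram matrix of
  vectors \<open>v i\<close> in \<open>\<real>\<^sup>m\<close>, with \<open>m\<close> minimal.  The vectors of \<open>S1\<close> and of \<open>S2\<close> have the same inner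
  products, so a linear isometry \<open>T\<close> maps the ones to the others.  It has a complex eigenvector
  \<open>a + \<i>b\<close>, with an eigenvalue of modulus \<open>1\<close>.  Hence the matrix
  \<open>\<langle>v i, a\<rangle>\<langle>v j, a\<rangle> + \<langle>v i, b\<rangle>\<langle>v j, b\<rangle>\<close> is again compatible with the identification, and up to a
  positive scalar it defines a form on the quotient that is dominated by the given one.  It is not
  zero by minimality of \<open>m\<close>, and by extremality the given form is a multiple of it.\<close>

text \<open>A matrix on the chordal complex descends to the quotient only if it takes equal values
  on all lifts of an edge. The hypothesis on common neighbours keeps this under control: two lifts
  either coincide or are matched by \<open>f\<close>, so agreement on \<open>S1\<close> and
  \<open>S2\<close> is the only condition. A single square would satisfy it if \<open>a\<close> were
  a real eigenvector of \<open>T\<close>, but a rotation has none. A complex eigenvector always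
  exists, and the sum of the squares for its real and imaginary parts is invariant; this is where
  the 2 comes from. The positive scalar is the inverse of |a|^2 + |b|^2, by Cauchy-Schwarz.
  Minimality of \<open>m\<close> makes the vectors \<open>v i\<close> span, so that they cannot all
  be orthogonal to both \<open>a\<close> and \<open>b\<close>. Chordality is what provides the Gram
  vectors: on a cycle of length 4, a partial matrix that is positive semidefinite on all cliques may
  have no completion. A chordal graph splits along clique separators, and Gram vectors of the two
  sides are glued by the same extension of isometries that yields \<open>T\<close>.\<close>

section \<open>Inner products and linear isometries\<close>

text \<open>Vectors of R^m are total functions of which only the entries below \<open>m\<close>
  count, so the dimension is a value that can be minimised and lowered.\<close>

definition dot :: "nat \<Rightarrow> (nat \<Rightarrow> real) \<Rightarrow> (nat \<Rightarrow> real) \<Rightarrow> real"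
  where "dot m x y = (\<Sum>a<m. x a * y a)"

lemma dot_commute: "dot m x y = dot m y x"
  by (simp add: dot_def mult.commute)

lemma dot_lincomb: "dot m (\<lambda>i. c * x i + d * y i) z = c * dot m x z + d * dot m y z"
  by (simp add: dot_def algebra_simps sum.distrib sum_distrib_left)

lemma dot_lincomb_right: "dot m z (\<lambda>i. c * x i + d * y i) = c * dot m z x + d * dot m z y"
  by (simp add: dot_def algebra_simps sum.distrib sum_distrib_left)

lemma dot_sum: "dot m (\<lambda>i. \<Sum>j\<in>J. c j * x j i) z = (\<Sum>j\<in>J. c j * dot m (x j) z)"
  unfolding dot_def sum_distrib_left sum_distrib_right
  by (subst sum.swap) (simp add: mult.assoc)

lemma dot_self_nonneg: "dot m x x \<ge> 0"
  by (simp add: dot_def sum_nonneg)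

lemma dot_self_eq_0_iff: "dot m x x = 0 \<longleftrightarrow> (\<forall>i<m. x i = 0)"
  by (simp add: dot_def sum_nonneg_eq_0_iff Ball_def)

lemma dot_cong: "(\<And>i. i < m \<Longrightarrow> x i = x' i) \<Longrightarrow> (\<And>i. i < m \<Longrightarrow> y i = y' i) \<Longrightarrow> dot m x y = dot m x' y'"
  by (simp add: dot_def)

lemma dot_mono_dim:
  assumes "m \<le> n" "\<And>i. i \<ge> m \<Longrightarrow> x i = 0"
  shows "dot n x y = dot m x y"
  unfolding dot_def by (rule sum.mono_neutral_right) (use assms in auto)

lemma Cauchy_Schwarz_dot: "(dot m x y)\<^sup>2 \<le> dot m x x * dot m y y"
  using Cauchy_Schwarz_ineq_sum[of x y "{..<m}"] by (simp add: dot_def power2_eq_square)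

text \<open>Linearity is an equality of whole functions, so that it rewrites freely. The inner
  product sees only the entries below \<open>m\<close>, hence vectors are compared only
  there.\<close>

definition isometry :: "nat \<Rightarrow> ((nat \<Rightarrow> real) \<Rightarrow> nat \<Rightarrow> real) \<Rightarrow> bool"
  where "isometry m T \<longleftrightarrow>
    (\<forall>c d x y. T (\<lambda>i. c * x i + d * y i) = (\<lambda>i. c * T x i + d * T y i)) \<and>
    (\<forall>x y. dot m (T x) (T y) = dot m x y)"

lemma isometry_lincomb: "isometry m T \<Longrightarrow> T (\<lambda>i. c * x i + d * y i) = (\<lambda>i. c * T x i + d * T y i)"
  and isometry_dot: "isometry m T \<Longrightarrow> dot m (T x) (T y) = dot m x y"
  unfolding isometry_def by auto

lemma isometry_id: "isometry m (\<lambda>x. x)"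
  by (simp add: isometry_def)

lemma isometry_comp: "isometry m T \<Longrightarrow> isometry m T' \<Longrightarrow> isometry m (\<lambda>x. T (T' x))"
  by (simp add: isometry_def)

text \<open>By linearity \<open>T x - T y\<close> is the image of \<open>x - y\<close>, a vector of
  norm zero.\<close>

lemma isometry_cong:
  assumes "isometry m T" "\<And>i. i < m \<Longrightarrow> x i = y i" "i < m"
  shows "T x i = T y i"
proof -
  have "T (\<lambda>i. 1 * x i + -1 * y i) = (\<lambda>i. 1 * T x i + -1 * T y i)"
    using assms(1) by (rule isometry_lincomb)
  then have "dot m (\<lambda>i. T x i - T y i) (\<lambda>i. T x i - T y i) = dot m (\<lambda>i. x i - y i) (\<lambda>i. x i - y i)"
    using isometry_dot[OF assms(1), of "\<lambda>i. x i - y i" "\<lambda>i. x i - y i"] by simp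
  also have "\<dots> = 0"
    using assms(2) by (simp add: dot_self_eq_0_iff)
  finally show ?thesis
    using assms(3) by (simp add: dot_self_eq_0_iff)
qed

lemma isometry_sum:
  assumes "isometry m T" "finite J"
  shows "T (\<lambda>i. \<Sum>j\<in>J. c j * x j i) = (\<lambda>i. \<Sum>j\<in>J. c j * T (x j) i)"
  using assms(2)
proof (induction J rule: finite_induct)
  case empty
  show ?case
    using isometry_lincomb[OF assms(1), of 0 "\<lambda>_. 0" 0 "\<lambda>_. 0"] by simp
next
  case (insert k J)
  have "T (\<lambda>i. c k * x k i + 1 * (\<Sum>j\<in>J. c j * x j i)) = (\<lambda>i. c k * T (x k) i + 1 * T (\<lambda>i. \<Sum>j\<in>J. c j * x j i) i)"
    by (rule isometry_lincomb[OF assms(1)])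
  then show ?case
    using insert by simp
qed

text \<open>The reflection in the hyperplane orthogonal to \<open>d\<close>. Its coefficient
  satisfies \<open>r x * dot m d d = 2 * dot m d x\<close>, which makes the mixed terms
  cancel.\<close>

lemma isometry_reflection:
  assumes "dot m d d \<noteq> 0"
  shows "isometry m (\<lambda>x i. x i - 2 * dot m d x / dot m d d * d i)"
proof -
  define r where "r x = 2 * dot m d x / dot m d d" for x
  have r_lin: "r (\<lambda>i. c * x i + e * y i) = c * r x + e * r y" for c e x y
    by (simp add: r_def dot_lincomb_right add_divide_distrib distrib_left mult.left_commute)
  have r: "r x * dot m d d = 2 * dot m d x" for x
    using assms by (simp add: r_def)
  have "dot m (\<lambda>i. x i - r x * d i) (\<lambda>i. y i - r y * d i) = dot m x y" for x y
  proof -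
    have "dot m (\<lambda>i. x i - r x * d i) (\<lambda>i. y i - r y * d i)
        = dot m (\<lambda>i. 1 * x i + - r x * d i) (\<lambda>i. 1 * y i + - r y * d i)"
      by simp
    also have "\<dots> = dot m x y - r y * dot m d x - r x * dot m d y + r x * (r y * dot m d d)"
      unfolding dot_lincomb dot_lincomb_right dot_commute[of m x d] by (simp add: algebra_simps)
    also have "\<dots> = dot m x y"
    proof -
      have "r x * (r y * dot m d d) = 2 * (r x * dot m d y)"
        by (simp add: r)
      moreover have "r x * (r y * dot m d d) = 2 * (r y * dot m d x)"
        using r[of x] by (simp add: mult.left_commute[of "r x" "r y"])
      ultimately show ?thesis
        by linarith
    qed
    finally show ?thesis .
  qed
  moreover have "(\<lambda>i. (c * x i + e * y i) - r (\<lambda>i. c * x i + e * y i) * d i)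
      = (\<lambda>i. c * (x i - r x * d i) + e * (y i - r y * d i))" for c e x y
    unfolding r_lin by (simp add: algebra_simps)
  ultimately show ?thesis
    unfolding isometry_def r_def by blast
qed

text \<open>If the isometry \<open>T\<close> is right on \<open>S\<close>, the reflection that swaps \<open>T (v s)\<close> and \<open>w s\<close> fixes the
  images of \<open>S\<close>, so composing with it corrects \<open>T\<close> at \<open>s\<close>.\<close>

lemma isometry_extension:
  assumes "finite S" "\<And>s t. s \<in> S \<Longrightarrow> t \<in> S \<Longrightarrow> dot m (v s) (v t) = dot m (w s) (w t)"
  shows "\<exists>T. isometry m T \<and> (\<forall>s\<in>S. \<forall>i<m. T (v s) i = w s i)"
  using assms
proof (induction S rule: finite_induct)
  case empty
  then show ?case using isometry_id by auto
next
  case (insert s S)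
  then obtain T where T: "isometry m T" "\<And>t i. t \<in> S \<Longrightarrow> i < m \<Longrightarrow> T (v t) i = w t i"
    by auto
  define d where "d i = T (v s) i - w s i" for i
  have d_eq: "d = (\<lambda>i. 1 * T (v s) i + -1 * w s i)"
    by (auto simp: d_def)
  show ?case
  proof (cases "dot m d d = 0")
    case True
    then show ?thesis
      using T by (auto simp: dot_self_eq_0_iff d_def)
  next
    case False
    define H where "H x i = x i - 2 * dot m d x / dot m d d * d i" for x i
    have H: "isometry m H"
      using isometry_reflection[OF False] unfolding H_def .
    have norm: "dot m (T (v s)) (T (v s)) = dot m (w s) (w s)"
      using insert.prems isometry_dot[OF T(1)] by simp
    have "dot m d d = dot m (T (v s)) (T (v s)) - 2 * dot m (T (v s)) (w s) + dot m (w s) (w s)"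
      unfolding d_eq dot_lincomb dot_lincomb_right by (simp add: dot_commute[of m "w s" "T (v s)"])
    moreover have "dot m d (T (v s)) = dot m (T (v s)) (T (v s)) - dot m (T (v s)) (w s)"
      unfolding d_eq dot_lincomb by (simp add: dot_commute[of m "w s" "T (v s)"])
    \<comment> \<open>Equal norms make the coefficient of the reflection at \<open>T (v s)\<close>
      equal to 1, so \<open>H\<close> subtracts exactly \<open>d\<close>.\<close>
    ultimately have "2 * dot m d (T (v s)) = dot m d d"
      using norm by simp
    then have Hs: "H (T (v s)) i = w s i" for i
      using False unfolding H_def by (simp add: d_def)
    have "H (T (v t)) i = w t i" if "t \<in> S" "i < m" for t i
    proof -
      have "dot m d (T (v t)) = dot m (T (v s)) (T (v t)) - dot m (w s) (T (v t))"
        unfolding d_eq dot_lincomb by simp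
      also have "dot m (w s) (T (v t)) = dot m (w s) (w t)"
        using T(2) that by (intro dot_cong) auto
      also have "dot m (T (v s)) (T (v t)) = dot m (w s) (w t)"
        using insert.prems that isometry_dot[OF T(1)] by simp
      finally show ?thesis
        using T(2) that by (simp add: H_def)
    qed
    then show ?thesis
      using Hs isometry_comp[OF H T(1)] by (intro exI[of _ "\<lambda>x. H (T x)"]) auto
  qed
qed

text \<open>The vectors \<open>a\<close> and \<open>b\<close> are the real and imaginary parts of a complex eigenvector of the matrix
  of \<open>T\<close>, for the eigenvalue \<open>\<alpha> + \<i>\<beta>\<close>.\<close>

lemma isometry_eigenplane:
  assumes T: "isometry m T" and "m > 0"
  obtains a b \<alpha> \<beta> where "\<exists>i<m. a i \<noteq> 0 \<or> b i \<noteq> 0"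
    "\<And>i. i < m \<Longrightarrow> T a i = \<alpha> * a i - \<beta> * b i" "\<And>i. i < m \<Longrightarrow> T b i = \<beta> * a i + \<alpha> * b i"
proof -
  define e where "e j i = (if i = j then 1 else 0 :: real)" for i j :: nat
  define A :: "complex mat" where "A = mat m m (\<lambda>(i, j). of_real (T (e j) i))"
  have A: "A \<in> carrier_mat m m"
    by (simp add: A_def)
  obtain \<kappa> u where "eigenvector A u \<kappa>"
    using spectrum_non_empty[OF A \<open>m > 0\<close>] by (auto simp: spectrum_def eigenvalue_def)
  then have u: "u \<in> carrier_vec m" "u \<noteq> 0\<^sub>v m" "A *\<^sub>v u = \<kappa> \<cdot>\<^sub>v u"
    using A by (auto simp: eigenvector_def)
  define a b where "a i = (if i < m then Re (u $ i) else 0)" and "b i = (if i < m then Im (u $ i) else 0)" for i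
  have T_eq: "T x i = (\<Sum>j<m. T (e j) i * x j)" if "i < m" for x i
  proof -
    \<comment> \<open>The expansion in unit vectors agrees with \<open>x\<close> only below
      \<open>m\<close>; \<open>isometry_cong\<close> bridges the difference.\<close>
    have "T x i = T (\<lambda>i. \<Sum>j<m. x j * e j i) i"
      by (rule isometry_cong[OF T _ that]) (simp add: e_def if_distrib[of "(*) _"] cong: if_cong)
    also have "\<dots> = (\<Sum>j<m. x j * T (e j) i)"
      by (simp add: isometry_sum[OF T])
    finally show ?thesis
      by (simp add: mult.commute)
  qed
  have eig: "(\<Sum>j<m. of_real (T (e j) i) * u $ j) = \<kappa> * u $ i" if "i < m" for i
  proof -
    have "(A *\<^sub>v u) $ i = (\<kappa> \<cdot>\<^sub>v u) $ i"
      using u by simp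
    then show ?thesis
      using u(1) that A by (simp add: A_def scalar_prod_def lessThan_atLeast0)
  qed
  have "T a i = Re \<kappa> * a i - Im \<kappa> * b i" "T b i = Im \<kappa> * a i + Re \<kappa> * b i" if "i < m" for i
    unfolding T_eq[OF that, of a] T_eq[OF that, of b]
    using arg_cong[OF eig[OF that], of Re] arg_cong[OF eig[OF that], of Im] that
    by (simp_all add: a_def b_def)
  moreover have "\<exists>i<m. u $ i \<noteq> 0"
    using u(1,2) by (metis carrier_vecD eq_vecI index_zero_vec)
  then have "\<exists>i<m. a i \<noteq> 0 \<or> b i \<noteq> 0"
    by (auto simp: a_def b_def complex_eq_iff)
  ultimately show thesis
    by (intro that[of a b "Re \<kappa>" "Im \<kappa>"]) auto
qed

text \<open>The eigenvalue \<open>\<alpha> + \<i>\<beta>\<close> has modulus 1, so \<open>T\<close> acts on its eigenplane as a rotation.\<close>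

lemma isometry_eigenplane_dot:
  assumes T: "isometry m T" and "m > 0"
  obtains a b where "\<exists>i<m. a i \<noteq> 0 \<or> b i \<noteq> 0"
    "\<And>x y. dot m (T x) a * dot m (T y) a + dot m (T x) b * dot m (T y) b
      = dot m x a * dot m y a + dot m x b * dot m y b"
proof -
  obtain a b \<alpha> \<beta> where ab: "\<exists>i<m. a i \<noteq> 0 \<or> b i \<noteq> 0"
    and Ta: "\<And>i. i < m \<Longrightarrow> T a i = \<alpha> * a i - \<beta> * b i"
    and Tb: "\<And>i. i < m \<Longrightarrow> T b i = \<beta> * a i + \<alpha> * b i"
    using isometry_eigenplane[OF assms] by blast
  have a: "dot m z (T a) = \<alpha> * dot m z a - \<beta> * dot m z b" for z
  proof -
    have "dot m z (T a) = dot m z (\<lambda>i. \<alpha> * a i + - \<beta> * b i)"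
      by (rule dot_cong) (simp_all add: Ta)
    then show ?thesis
      unfolding dot_lincomb_right by simp
  qed
  have b: "dot m z (T b) = \<beta> * dot m z a + \<alpha> * dot m z b" for z
    unfolding dot_lincomb_right[symmetric] by (rule dot_cong) (simp_all add: Tb)
  have "dot m (T a) (T a) = \<alpha>\<^sup>2 * dot m a a - 2 * \<alpha> * \<beta> * dot m a b + \<beta>\<^sup>2 * dot m b b"
    unfolding a dot_commute[of m "T a" a] dot_commute[of m "T a" b]
    by (simp add: dot_commute[of m b a] algebra_simps power2_eq_square)
  moreover have "dot m (T b) (T b) = \<beta>\<^sup>2 * dot m a a + 2 * \<alpha> * \<beta> * dot m a b + \<alpha>\<^sup>2 * dot m b b"
    unfolding b dot_commute[of m "T b" a] dot_commute[of m "T b" b]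
    by (simp add: dot_commute[of m b a] algebra_simps power2_eq_square)
  \<comment> \<open>The terms with \<open>dot m a b\<close> cancel in the sum, and \<open>T\<close>
    preserves both norms.\<close>
  ultimately have "dot m a a + dot m b b = (\<alpha>\<^sup>2 + \<beta>\<^sup>2) * (dot m a a + dot m b b)"
    unfolding isometry_dot[OF T] by (simp add: algebra_simps)
  moreover have "dot m a a + dot m b b \<noteq> 0"
    using ab dot_self_nonneg[of m a] dot_self_nonneg[of m b]
    by (metis add_nonneg_eq_0_iff dot_self_eq_0_iff)
  ultimately have modulus: "\<alpha>\<^sup>2 + \<beta>\<^sup>2 = 1"
    by simp
  \<comment> \<open>Taking \<open>z = T x\<close> in the two equations moves \<open>T\<close> off
    \<open>a\<close> and \<open>b\<close> without an inverse of \<open>T\<close>.\<close>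
  have Ax: "dot m x a = \<alpha> * dot m (T x) a - \<beta> * dot m (T x) b"
    and Bx: "dot m x b = \<beta> * dot m (T x) a + \<alpha> * dot m (T x) b" for x
    using a[of "T x"] b[of "T x"] isometry_dot[OF T] by simp_all
  have "dot m x a * dot m y a + dot m x b * dot m y b
      = (\<alpha>\<^sup>2 + \<beta>\<^sup>2) * (dot m (T x) a * dot m (T y) a + dot m (T x) b * dot m (T y) b)" for x y
    unfolding Ax[of x] Ax[of y] Bx[of x] Bx[of y] by (simp add: algebra_simps power2_eq_square)
  then have "dot m (T x) a * dot m (T y) a + dot m (T x) b * dot m (T y) b
      = dot m x a * dot m y a + dot m x b * dot m y b" for x y
    unfolding modulus by simp
  then show thesis
    by (rule that[OF ab])
qed

lemma gram_reduce_dim: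
  assumes "\<And>i. i \<in> I \<Longrightarrow> dot (Suc m) (v i) d = 0" "dot (Suc m) d d \<noteq> 0"
  obtains w where "\<And>i j. i \<in> I \<Longrightarrow> j \<in> I \<Longrightarrow> dot m (w i) (w j) = dot (Suc m) (v i) (v j)"
proof -
  define c where "c = 1 / sqrt (dot (Suc m) d d)"
  have c: "c * c * dot (Suc m) d d = 1"
    using assms(2) dot_self_nonneg[of "Suc m" d] by (simp add: c_def)
  \<comment> \<open>The zero summand gives \<open>d'\<close> the shape required by
    \<open>dot_lincomb\<close>.\<close>
  define d' where "d' i = c * d i + 0 * d i" for i
  define e where "e i = (if i = m then 1 else 0 :: real)" for i
  have "dot (Suc m) d' d' = dot (Suc m) e e"
    using c unfolding d'_def dot_lincomb dot_lincomb_right by (simp add: dot_def e_def)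
  then obtain T where T: "isometry (Suc m) T" "\<And>i. i < Suc m \<Longrightarrow> T d' i = e i"
    using isometry_extension[of "{()}" "Suc m" "\<lambda>_. d'" "\<lambda>_. e"] by auto
  have "T (v i) m = 0" if "i \<in> I" for i
  proof -
    have "T (v i) m = dot (Suc m) (T (v i)) e"
      by (simp add: dot_def e_def)
    also have "\<dots> = dot (Suc m) (T (v i)) (T d')"
      using T(2) by (intro dot_cong) auto
    also have "\<dots> = c * dot (Suc m) (v i) d"
      unfolding isometry_dot[OF T(1)] d'_def dot_lincomb_right by simp
    finally show ?thesis
      using assms(1) that by simp
  qed
  then have "dot m (T (v i)) (T (v j)) = dot (Suc m) (v i) (v j)" if "i \<in> I" "j \<in> I" for i j
    unfolding isometry_dot[OF T(1), of "v i" "v j", symmetric] using that by (simp add: dot_def)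
  then show thesis
    by (rule that)
qed

section \<open>Positive semidefinite matrices\<close>

definition form :: "'v set \<Rightarrow> ('v \<Rightarrow> 'v \<Rightarrow> real) \<Rightarrow> ('v \<Rightarrow> real) \<Rightarrow> real"
  where "form F M x = (\<Sum>i\<in>F. \<Sum>j\<in>F. M i j * x i * x j)"

definition psd_on :: "'a set \<Rightarrow> ('a \<Rightarrow> 'a \<Rightarrow> real) \<Rightarrow> bool"
  where "psd_on F M \<longleftrightarrow> (\<forall>x. 0 \<le> form F M x)"

lemma psd_on_diag:
  assumes "finite F" "psd_on F M" "i \<in> F"
  shows "M i i \<ge> 0"
proof -
  have "(\<Sum>k\<in>F. \<Sum>j\<in>F. M k j * of_bool (k = i) * of_bool (j = i)) = M i i"
    using assms(1,3) by (simp add: of_bool_def if_distrib[of "(*) _"] cong: if_cong)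
  moreover have "0 \<le> (\<Sum>k\<in>F. \<Sum>j\<in>F. M k j * of_bool (k = i) * of_bool (j = i))"
    using assms(2) spec[of _ "\<lambda>k. of_bool (k = i)"] unfolding psd_on_def form_def by blast
  ultimately show ?thesis
    by simp
qed

text \<open>Ordered by powers of \<open>x r\<close>, as needed to complete the square.\<close>

lemma psd_on_insert_form:
  fixes M :: "'a \<Rightarrow> 'a \<Rightarrow> real"
  assumes "finite F" "r \<notin> F" "\<And>i j. M i j = M j i"
  shows "(\<Sum>i\<in>insert r F. \<Sum>j\<in>insert r F. M i j * x i * x j)
    = M r r * (x r)\<^sup>2 + 2 * x r * (\<Sum>j\<in>F. M r j * x j) + (\<Sum>i\<in>F. \<Sum>j\<in>F. M i j * x i * x j)"
proof -
  have "(\<Sum>i\<in>F. M i r * x i * x r) = x r * (\<Sum>j\<in>F. M r j * x j)"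
    unfolding sum_distrib_left
  proof (rule sum.cong)
    show "M i r * x i * x r = x r * (M r i * x i)" for i
      using assms(3)[of i r] by simp
  qed simp
  moreover have "(\<Sum>j\<in>F. M r j * x r * x j) = x r * (\<Sum>j\<in>F. M r j * x j)"
    unfolding sum_distrib_left by (intro sum.cong) auto
  ultimately show ?thesis
    using assms(1,2) by (simp add: sum.distrib power2_eq_square)
qed

text \<open>Schur complement: eliminating \<open>r\<close> subtracts the square of the column of \<open>r\<close>, divided by
  \<open>M r r\<close>.  If \<open>M r r = 0\<close> the column vanishes and the division gives \<open>0\<close>.\<close>

lemma psd_on_schur:
  assumes fin: "finite F" and r: "r \<notin> F" and sym: "\<And>i j. M i j = M j i" and psd: "psd_on (insert r F) M"
  shows "psd_on F (\<lambda>i j. M i j - M r i * M r j / M r r)"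
    and "M r r = 0 \<Longrightarrow> j \<in> F \<Longrightarrow> M r j = 0"
proof -
  have diag: "M r r \<ge> 0"
    using psd_on_diag[OF _ psd, of r] fin by simp
  have form: "0 \<le> M r r * t\<^sup>2 + 2 * t * (\<Sum>j\<in>F. M r j * x j) + (\<Sum>i\<in>F. \<Sum>j\<in>F. M i j * x i * x j)" for t x
  proof -
    have "0 \<le> (\<Sum>i\<in>insert r F. \<Sum>j\<in>insert r F. M i j * (x(r := t)) i * (x(r := t)) j)"
      using psd unfolding psd_on_def form_def by blast
    also have "\<dots> = M r r * t\<^sup>2 + 2 * t * (\<Sum>j\<in>F. M r j * (x(r := t)) j)
        + (\<Sum>i\<in>F. \<Sum>j\<in>F. M i j * (x(r := t)) i * (x(r := t)) j)"
      unfolding psd_on_insert_form[OF fin r sym] by simp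
    also have "(\<Sum>j\<in>F. M r j * (x(r := t)) j) = (\<Sum>j\<in>F. M r j * x j)"
      by (intro sum.cong) (use r in auto)
    also have "(\<Sum>i\<in>F. \<Sum>j\<in>F. M i j * (x(r := t)) i * (x(r := t)) j) = (\<Sum>i\<in>F. \<Sum>j\<in>F. M i j * x i * x j)"
      by (intro sum.cong) (use r in auto)
    finally show ?thesis .
  qed
  have zero: "(\<Sum>j\<in>F. M r j * x j) = 0" if "M r r = 0" for x
  proof (rule ccontr)
    assume L: "(\<Sum>j\<in>F. M r j * x j) \<noteq> 0"
    define Q where "Q = (\<Sum>i\<in>F. \<Sum>j\<in>F. M i j * x i * x j)"
    \<comment> \<open>With \<open>M r r = 0\<close> the form is affine in the coordinate at
      \<open>r\<close>, so a suitable value of that coordinate makes the total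
      \<open>-1\<close>.\<close>
    have "0 \<le> 2 * (- (Q + 1) / (2 * (\<Sum>j\<in>F. M r j * x j))) * (\<Sum>j\<in>F. M r j * x j) + Q"
      using form[of "- (Q + 1) / (2 * (\<Sum>j\<in>F. M r j * x j))" x] that by (simp add: Q_def)
    also have "\<dots> = -1"
      using L by (simp add: field_simps)
    finally show False
      by simp
  qed
  show "M r j = 0" if "M r r = 0" "j \<in> F" for j
  proof -
    have "(\<Sum>i\<in>F. M r i * of_bool (i = j)) = M r j"
      using fin that by (simp add: of_bool_def if_distrib[of "(*) _"] cong: if_cong)
    then show ?thesis
      using zero[OF that(1)] by metis
  qed
  show "psd_on F (\<lambda>i j. M i j - M r i * M r j / M r r)"
    unfolding psd_on_def form_def
  proof
    fix x
    define L where "L = (\<Sum>j\<in>F. M r j * x j)"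
    have "(\<Sum>i\<in>F. \<Sum>j\<in>F. (M i j - M r i * M r j / M r r) * x i * x j)
        = (\<Sum>i\<in>F. \<Sum>j\<in>F. M i j * x i * x j) - L * L / M r r"
      unfolding L_def sum_product sum_divide_distrib sum_subtractf[symmetric]
      by (intro sum.cong refl) (simp add: algebra_simps)
    also have "\<dots> \<ge> 0"
    proof (cases "M r r = 0")
      case False
      \<comment> \<open>The minimum over the coordinate at \<open>r\<close> is attained at
        \<open>- L / M r r\<close>.\<close>
      then have "M r r * (- L / M r r)\<^sup>2 + 2 * (- L / M r r) * L = - (L * L / M r r)"
        by (simp add: power2_eq_square)
      then show ?thesis
        using form[of "- L / M r r" x] unfolding L_def[symmetric] by linarith
    qed (use form[of 0 x] in simp)
    finally show "0 \<le> (\<Sum>i\<in>F. \<Sum>j\<in>F. (M i j - M r i * M r j / M r r) * x i * x j)" .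
  qed
qed

text \<open>Cholesky factorisation by induction: the Schur complement of one index has Gram vectors,
  and one extra coordinate restores the subtracted square.\<close>

lemma psd_on_gram:
  assumes "finite F" "\<And>i j. M i j = M j i" "psd_on F M"
  shows "\<exists>m v. \<forall>i\<in>F. \<forall>j\<in>F. M i j = dot m (v i) (v j)"
  using assms
proof (induction F arbitrary: M rule: finite_induct)
  case (insert r F)
  note schur = psd_on_schur[OF insert.hyps insert.prems]
  have diag: "M r r \<ge> 0"
    using psd_on_diag[OF _ insert.prems(2), of r] insert.hyps by simp
  have "M i j - M r i * M r j / M r r = M j i - M r j * M r i / M r r" for i j
    using insert.prems(1)[of i j] by (simp add: mult.commute)
  then obtain m v where v: "\<And>i j. i \<in> F \<Longrightarrow> j \<in> F \<Longrightarrow> M i j - M r i * M r j / M r r = dot m (v i) (v j)"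
    using insert.IH[OF _ schur(1)] by metis
  \<comment> \<open>The vector of \<open>r\<close> has only the new coordinate, equal to
    \<open>sqrt (M r r)\<close>. If \<open>M r r = 0\<close>, division by zero makes the new
    coordinates 0, which is right because the column of \<open>r\<close> vanishes by
    \<open>schur(2)\<close>.\<close>
  define w where "w i a = (if a = m then M r i / sqrt (M r r) else if i = r then 0 else v i a)" for i a
  have "M i j = dot (Suc m) (w i) (w j)" if "i \<in> insert r F" "j \<in> insert r F" for i j
  proof -
    have "dot (Suc m) (w i) (w j) = dot m (w i) (w j) + M r i * M r j / M r r"
      using diag by (simp add: dot_def w_def)
    also have "dot m (w i) (w j) = (if i = r \<or> j = r then 0 else dot m (v i) (v j))"
      by (auto simp: dot_def w_def)
    finally show ?thesis
      using that v[of i j] schur(2)[of i] schur(2)[of j] insert.prems(1)[of i r]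
      by (cases "M r r = 0") auto
  qed
  then show ?case
    by blast
qed simp

section \<open>Completion over chordal graphs\<close>

lemma successively_shortcut:
  assumes p: "successively P p" and ij: "i < j" "j < length p" and step: "P (p ! i) (p ! j)"
  shows "successively P (take (Suc i) p @ drop j p)"
    and "hd (take (Suc i) p @ drop j p) = hd p" "last (take (Suc i) p @ drop j p) = last p"
proof -
  have "successively P (take (Suc i) p)" "successively P (drop j p)"
    using p by (metis append_take_drop_id successively_append_iff)+
  moreover have "last (take (Suc i) p) = p ! i" "hd (drop j p) = p ! j"
    using ij by (simp_all add: hd_drop_conv_nth take_Suc_conv_app_nth)
  ultimately show "successively P (take (Suc i) p @ drop j p)"
    using step by (simp add: successively_append_iff)
  show "hd (take (Suc i) p @ drop j p) = hd p" "last (take (Suc i) p @ drop j p) = last p"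
    using ij by (cases p; simp)+
qed

text \<open>Among the walks inside \<open>set p\<close> with the same ends, a shortest one has no
  chords, since a chord would be a shortcut.\<close>

lemma shortest_walk:
  assumes "p \<noteq> []" "successively P p"
  obtains q where "q \<noteq> []" "successively P q" "hd q = hd p" "last q = last p" "set q \<subseteq> set p" "distinct q"
    "\<And>i j. i < j \<Longrightarrow> j < length q \<Longrightarrow> P (q ! i) (q ! j) \<Longrightarrow> j = Suc i"
proof -
  define W where "W q \<longleftrightarrow> q \<noteq> [] \<and> successively P q \<and> hd q = hd p \<and> last q = last p \<and> set q \<subseteq> set p" for q
  have "W p"
    using assms by (simp add: W_def)
  then obtain q where q: "W q" and min: "\<And>q'. W q' \<Longrightarrow> length q \<le> length q'"
    using ex_has_least_nat[of W p length] by blast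
  have ind: "j = Suc i" if "i < j" "j < length q" "P (q ! i) (q ! j)" for i j
  proof (rule ccontr)
    assume "j \<noteq> Suc i"
    have "set (take (Suc i) q @ drop j q) \<subseteq> set p"
      using q set_take_subset[of "Suc i" q] set_drop_subset[of j q] unfolding W_def by auto
    then have "W (take (Suc i) q @ drop j q)"
      using successively_shortcut[of P q i j] that q unfolding W_def by auto
    from min[OF this] show False
      using that \<open>j \<noteq> Suc i\<close> by simp
  qed
  have "q ! i \<noteq> q ! j" if "i < j" "j < length q" for i j
  proof
    assume eq: "q ! i = q ! j"
    \<comment> \<open>After a repetition one could jump from \<open>i\<close> to the successor of
      \<open>j\<close>; if \<open>j\<close> is the last position, the walk may already stop at
      \<open>i\<close>.\<close>
    show False
    proof (cases "Suc j < length q")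
      case True
      then have "P (q ! j) (q ! Suc j)"
        using q unfolding W_def by (simp add: successively_conv_nth)
      then have "Suc j = Suc i"
        using ind[of i "Suc j"] True that eq by simp
      then show False
        using that by simp
    next
      case False
      then have j: "j = length q - 1"
        using that by simp
      have "successively P (take (Suc i) q)"
        using q unfolding W_def by (metis append_take_drop_id successively_append_iff)
      moreover have "last (take (Suc i) q) = last q" "hd (take (Suc i) q) = hd q"
        using that eq j q unfolding W_def by (auto simp: take_Suc_conv_app_nth last_conv_nth hd_append hd_conv_nth)
      ultimately have "W (take (Suc i) q)"
        using q set_take_subset[of "Suc i" q] unfolding W_def by auto
      from min[OF this] show False
        using that by simp
    qed
  qed
  then have "distinct q"
    by (metis distinct_conv_nth linorder_neqE_nat)
  then show thesis
    using q ind unfolding W_def by (intro that[of q]) auto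
qed

lemma rtrancl_imp_walk:
  assumes "(x, y) \<in> {(a, b). a \<in> C \<and> b \<in> C \<and> P a b}\<^sup>*" "x \<in> C"
  shows "\<exists>p. p \<noteq> [] \<and> hd p = x \<and> last p = y \<and> set p \<subseteq> C \<and> successively P p"
  using assms(1)
proof (induction rule: rtrancl_induct)
  case base
  show ?case
    using assms(2) by (intro exI[of _ "[x]"]) auto
next
  case (step y z)
  then obtain p where "p \<noteq> []" "hd p = x" "last p = y" "set p \<subseteq> C" "successively P p"
    by auto
  then show ?case
    using step(2) by (intro exI[of _ "p @ [z]"]) (auto simp: successively_append_iff)
qed

text \<open>A shortest walk from \<open>x\<close> through the connected set \<open>C\<close> to
  \<open>y\<close> is induced. As \<open>x\<close> and \<open>y\<close> are distinct and not
  adjacent, it has an interior vertex, so two such paths close up to a cycle of length at least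
  4.\<close>

lemma induced_path_through:
  assumes conn: "\<And>a b. a \<in> C \<Longrightarrow> b \<in> C \<Longrightarrow> (a, b) \<in> {(a, b). a \<in> C \<and> b \<in> C \<and> P a b}\<^sup>*"
    and x: "\<exists>a\<in>C. P x a" and y: "\<exists>b\<in>C. P b y" and "x \<noteq> y" "\<not> P x y"
  obtains q where "length q \<ge> 3" "q ! 0 = x" "q ! (length q - 1) = y" "set q \<subseteq> C \<union> {x, y}" "distinct q"
    "\<And>i. Suc i < length q \<Longrightarrow> P (q ! i) (q ! Suc i)"
    "\<And>i j. i < j \<Longrightarrow> j < length q \<Longrightarrow> P (q ! i) (q ! j) \<Longrightarrow> j = Suc i"
proof -
  obtain a b where ab: "a \<in> C" "P x a" "b \<in> C" "P b y"
    using x y by auto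
  obtain p where p: "p \<noteq> []" "hd p = a" "last p = b" "set p \<subseteq> C" "successively P p"
    using rtrancl_imp_walk[OF conn[OF ab(1,3)] ab(1)] by auto
  have walk: "x # p @ [y] \<noteq> []" "successively P (x # p @ [y])"
    using p ab by (auto simp: successively_append_iff successively_Cons)
  obtain q where q: "q \<noteq> []" "successively P q" "hd q = hd (x # p @ [y])" "last q = last (x # p @ [y])"
    "set q \<subseteq> set (x # p @ [y])" "distinct q"
    "\<And>i j. i < j \<Longrightarrow> j < length q \<Longrightarrow> P (q ! i) (q ! j) \<Longrightarrow> j = Suc i"
    using shortest_walk[OF walk] by blast
  have q0: "q ! 0 = x" and ql: "q ! (length q - 1) = y"
    using q(1,3,4) by (auto simp: hd_conv_nth last_conv_nth)
  have steps: "P (q ! i) (q ! Suc i)" if "Suc i < length q" for i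
    using q(2) that by (simp add: successively_conv_nth)
  have "length q \<noteq> 1"
    using q0 ql \<open>x \<noteq> y\<close> by auto
  moreover have "length q \<noteq> 2"
    using q0 ql steps[of 0] \<open>\<not> P x y\<close> by auto
  moreover have "length q \<noteq> 0"
    using q(1) by simp
  ultimately have "length q \<ge> 3"
    by linarith
  moreover have "set q \<subseteq> C \<union> {x, y}"
    using q(5) p(4) by auto
  ultimately show thesis
    using that[OF _ q0 ql _ q(6) steps q(7)] by blast
qed

lemma distinct_interior_nth:
  assumes "distinct p" "0 < i" "i < length p - 1"
  shows "p ! i \<noteq> p ! 0" "p ! i \<noteq> p ! (length p - 1)"
  using assms nth_eq_iff_index_eq[OF assms(1), of i 0] nth_eq_iff_index_eq[OF assms(1), of i "length p - 1"]
  by (cases p; force)+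

lemma simple_graph_edge_neq: "simple_graph V E \<Longrightarrow> {x, y} \<in> E \<Longrightarrow> x \<noteq> y"
  unfolding simple_graph_def by fastforce

text \<open>Induced paths from \<open>x\<close> to \<open>y\<close> through \<open>A\<close> and back through \<open>B\<close> form an induced cycle.\<close>

lemma chordal_common_neighbours_adjacent:
  assumes chordal: "chordal_graph V E"
    and sub: "A \<subseteq> V" "B \<subseteq> V" "x \<in> V" "y \<in> V" and disj: "A \<inter> B = {}"
    and sep: "\<And>a b. a \<in> A \<Longrightarrow> b \<in> B \<Longrightarrow> {a, b} \<notin> E"
    and A: "\<And>a b. a \<in> A \<Longrightarrow> b \<in> A \<Longrightarrow> (a, b) \<in> {(a, b). a \<in> A \<and> b \<in> A \<and> {a, b} \<in> E}\<^sup>*"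
    and B: "\<And>a b. a \<in> B \<Longrightarrow> b \<in> B \<Longrightarrow> (a, b) \<in> {(a, b). a \<in> B \<and> b \<in> B \<and> {a, b} \<in> E}\<^sup>*"
    and xy: "x \<notin> A \<union> B" "y \<notin> A \<union> B" "x \<noteq> y"
    and nbrs: "\<exists>a\<in>A. {x, a} \<in> E" "\<exists>a\<in>A. {a, y} \<in> E" "\<exists>b\<in>B. {x, b} \<in> E" "\<exists>b\<in>B. {b, y} \<in> E"
  shows "{x, y} \<in> E"
proof (rule ccontr)
  assume nonadj: "{x, y} \<notin> E"
  obtain p where p: "length p \<ge> 3" "p ! 0 = x" "p ! (length p - 1) = y" "set p \<subseteq> A \<union> {x, y}" "distinct p"
    "\<And>i. Suc i < length p \<Longrightarrow> {p ! i, p ! Suc i} \<in> E"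
    "\<And>i j. i < j \<Longrightarrow> j < length p \<Longrightarrow> {p ! i, p ! j} \<in> E \<Longrightarrow> j = Suc i"
    using induced_path_through[of A "\<lambda>a b. {a, b} \<in> E" x y] A nbrs xy(3) nonadj by blast
  obtain q where q: "length q \<ge> 3" "q ! 0 = x" "q ! (length q - 1) = y" "set q \<subseteq> B \<union> {x, y}" "distinct q"
    "\<And>i. Suc i < length q \<Longrightarrow> {q ! i, q ! Suc i} \<in> E"
    "\<And>i j. i < j \<Longrightarrow> j < length q \<Longrightarrow> {q ! i, q ! j} \<in> E \<Longrightarrow> j = Suc i"
    using induced_path_through[of B "\<lambda>a b. {a, b} \<in> E" x y] B nbrs xy(3) nonadj by blast
  have p_iff: "{p ! i, p ! j} \<in> E \<longleftrightarrow> j = Suc i" if "i < j" "j < length p" for i j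
    using p(6)[of i] p(7)[of i j] that by auto
  have q_iff: "{q ! i, q ! j} \<in> E \<longleftrightarrow> j = Suc i" if "i < j" "j < length q" for i j
    using q(6)[of i] q(7)[of i j] that by auto
  have p_int: "p ! i \<in> A" if "0 < i" "i < length p - 1" for i
  proof -
    have "p ! i \<noteq> x" "p ! i \<noteq> y"
      using distinct_interior_nth[OF p(5) that] p(2,3) by auto
    moreover have "p ! i \<in> set p"
      using that by simp
    ultimately show ?thesis
      using p(4) by auto
  qed
  have q_int: "q ! i \<in> B" if "0 < i" "i < length q - 1" for i
  proof -
    have "q ! i \<noteq> x" "q ! i \<noteq> y"
      using distinct_interior_nth[OF q(5) that] q(2,3) by auto
    moreover have "q ! i \<in> set q"
      using that by simp
    ultimately show ?thesis
      using q(4) by auto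
  qed
  \<comment> \<open>\<open>r\<close> runs backwards through the interior of \<open>q\<close>, from
    position \<open>length q - 2\<close> down to 1; the ends \<open>x\<close> and \<open>y\<close>
    already occur in \<open>p\<close>.\<close>
  define r where "r t = q ! (length q - 2 - t)" for t
  define c where "c = p @ map r [0..<length q - 2]"
  have len: "length c = length p + (length q - 2)"
    by (simp add: c_def)
  have c_p: "c ! i = p ! i" if "i < length p" for i
    using that by (simp add: c_def nth_append)
  have c_q: "c ! (length p + t) = r t" if "t < length q - 2" for t
    using that by (simp add: c_def nth_append)
  have rB: "r t \<in> B" if "t < length q - 2" for t
    unfolding r_def using that by (intro q_int) auto
  have "inj_on r {0..<length q - 2}"
    using q(1,5) by (auto simp: inj_on_def r_def nth_eq_iff_index_eq)
  moreover have "set p \<inter> r ` {0..<length q - 2} = {}"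
    using rB p(4) xy disj by fastforce
  ultimately have "distinct c"
    using p(5) by (simp add: c_def distinct_map)
  moreover have "set c \<subseteq> V"
    using p(4) rB sub by (auto simp: c_def)
  moreover have "{c ! i, c ! j} \<in> E \<longleftrightarrow> j = i + 1 \<or> (i = 0 \<and> j = length c - 1)"
    if ij: "i < j" "j < length c" for i j
  proof (cases "j < length p")
    case True
    then show ?thesis
      using ij p_iff[of i j] q(1) by (auto simp: c_p len)
  next
    case False
    then obtain t where t: "j = length p + t" "t < length q - 2"
      using ij(2) unfolding len by (metis add_less_cancel_left le_add_diff_inverse not_less)
    have qlen: "length q - 2 - t < length q - 1" "0 < length q - 2 - t"
      using t by auto
    show ?thesis
    proof (cases "i < length p")
      case True
      \<comment> \<open>Between \<open>p\<close> and the way back, \<open>x\<close> meets only the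
        last vertex of the cycle and \<open>y\<close> only the first vertex after \<open>p\<close>;
        the interior of \<open>p\<close> lies in \<open>A\<close> and has no edges to
        \<open>B\<close>.\<close>
      consider "i = 0" | "i = length p - 1" "i \<noteq> 0" | "0 < i" "i < length p - 1"
        using True by linarith
      then show ?thesis
      proof cases
        case 1
        then have "{c ! i, c ! j} \<in> E \<longleftrightarrow> length q - 2 - t = 1"
          using q_iff[of 0 "length q - 2 - t"] qlen p(2) q(2) True t by (simp add: c_p c_q r_def)
        then show ?thesis
          using 1 t p(1) by (auto simp: len)
      next
        case 2
        then have "{c ! i, c ! j} \<in> E \<longleftrightarrow> length q - 1 = Suc (length q - 2 - t)"
          using q_iff[of "length q - 2 - t" "length q - 1"] qlen p(3) q(3) True t
          by (simp add: c_p c_q r_def insert_commute)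
        then show ?thesis
          using 2 t p(1) by auto
      next
        case 3
        then have "{c ! i, c ! j} \<notin> E"
          using sep[OF p_int rB] True t by (simp add: c_p c_q)
        then show ?thesis
          using 3 t by auto
      qed
    next
      case False
      then obtain s where s: "i = length p + s" "s < t"
        using ij(1) t by (metis add_less_cancel_left le_add_diff_inverse not_less)
      then have "{c ! i, c ! j} \<in> E \<longleftrightarrow> length q - 2 - s = Suc (length q - 2 - t)"
        using q_iff[of "length q - 2 - t" "length q - 2 - s"] qlen t
        by (simp add: c_q r_def insert_commute)
      then show ?thesis
        using s t p(1) by auto
    qed
  qed
  ultimately have "induced_cycle V E c" "length c \<ge> 4"
    unfolding induced_cycle_def using p(1) q(1) len by auto
  then show False
    using chordal unfolding chordal_graph_def by blast
qed

text \<open>Dirac's argument: a minimum set separating \<open>u\<close> from \<open>v\<close> is a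
  clique, because by minimality each of its vertices has neighbours in the components of both
  \<open>u\<close> and \<open>v\<close>.\<close>

lemma chordal_clique_separator:
  assumes chordal: "chordal_graph V E" and W: "W \<subseteq> V" and uv: "u \<in> W" "v \<in> W" "u \<noteq> v" "{u, v} \<notin> E"
  obtains A B S where "W = A \<union> B \<union> S" "u \<in> A" "v \<in> B" "A \<inter> B = {}" "A \<inter> S = {}" "B \<inter> S = {}"
    "\<And>a b. a \<in> A \<Longrightarrow> b \<in> B \<Longrightarrow> {a, b} \<notin> E"
    "\<And>x y. x \<in> S \<Longrightarrow> y \<in> S \<Longrightarrow> x \<noteq> y \<Longrightarrow> {x, y} \<in> E"
proof -
  have simple: "simple_graph V E" and fin: "finite W"
    using chordal W finite_subset unfolding chordal_graph_def simple_graph_def by auto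
  define R where "R X = {(a, b). a \<in> X \<and> b \<in> X \<and> {a, b} \<in> E}" for X
  have sym: "(b, a) \<in> (R X)\<^sup>*" if "(a, b) \<in> (R X)\<^sup>*" for a b X
  proof -
    have "sym (R X)"
      by (auto simp: sym_def R_def insert_commute)
    then show ?thesis
      using that sym_rtrancl symD by metis
  qed
  define sepr where "sepr S \<longleftrightarrow> S \<subseteq> W - {u, v} \<and> (u, v) \<notin> (R (W - S))\<^sup>*" for S
  \<comment> \<open>Only the two non-adjacent vertices remain, so a separating set exists.\<close>
  have "R (W - (W - {u, v})) = {}"
    using uv simple_graph_edge_neq[OF simple] by (auto simp: R_def insert_commute)
  then have "sepr (W - {u, v})"
    using uv(3) by (simp add: sepr_def)
  then obtain S where S: "sepr S" and min: "\<And>S'. sepr S' \<Longrightarrow> card S \<le> card S'"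
    using ex_has_least_nat[of sepr _ card] by blast
  define comp where "comp z = {a. (z, a) \<in> (R (W - S))\<^sup>*}" for z
  have uvS: "u \<in> W - S" "v \<in> W - S"
    using S uv by (auto simp: sepr_def)
  have comp_self: "z \<in> comp z" for z
    by (simp add: comp_def)
  have comp_sub: "comp z \<subseteq> W - S" if "z \<in> W - S" for z
  proof
    fix a assume "a \<in> comp z"
    then have "(z, a) \<in> (R (W - S))\<^sup>*"
      by (simp add: comp_def)
    then show "a \<in> W - S"
      by (cases rule: rtranclE) (use that in \<open>auto simp: R_def\<close>)
  qed
  have comp_closed: "b \<in> comp z" if "a \<in> comp z" "b \<in> W - S" "{a, b} \<in> E" "z \<in> W - S" for a b z
    using that comp_sub[of z] unfolding comp_def R_def by (auto intro: rtrancl_into_rtrancl)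
  have comp_disj: "comp u \<inter> comp v = {}"
    using S sym rtrancl_trans[of u _ "R (W - S)" v] unfolding sepr_def comp_def by blast
  have comp_conn: "(a, b) \<in> (R (comp z))\<^sup>*" if "a \<in> comp z" "b \<in> comp z" "z \<in> W - S" for a b z
  proof -
    have "(z, a) \<in> (R (comp z))\<^sup>*" if "(z, a) \<in> (R (W - S))\<^sup>*" for a
      using that
    proof (induction rule: rtrancl_induct)
      case (step y a)
      then have "(y, a) \<in> R (comp z)"
        unfolding R_def comp_def by (auto intro: rtrancl_into_rtrancl)
      then show ?case
        using step.IH by (rule rtrancl_into_rtrancl[rotated])
    qed simp
    then show ?thesis
      using that sym rtrancl_trans[of a z "R (comp z)" b] unfolding comp_def by blast
  qed
  have nbr: "\<exists>a\<in>comp z. {x, a} \<in> E" if "x \<in> S" "z \<in> {u, v}" for x z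
  proof (rule ccontr)
    assume none: "\<not> (\<exists>a\<in>comp z. {x, a} \<in> E)"
    define z' where "z' = (if z = u then v else u)"
    have z: "z \<in> W - S" "z' \<in> comp z \<Longrightarrow> False"
      using uvS that(2) comp_disj comp_self[of u] comp_self[of v] uv(3) unfolding z'_def by (auto split: if_splits)
    \<comment> \<open>By minimality, returning \<open>x\<close> to the graph connects
      \<open>u\<close> and \<open>v\<close>. Without a neighbour of \<open>x\<close> in
      \<open>comp z\<close>, however, a walk from \<open>z\<close> could never leave
      \<open>comp z\<close>.\<close>
    have "card (S - {x}) < card S"
      using that(1) S fin finite_subset[of S W] by (intro psubset_card_mono) (auto simp: sepr_def)
    then have "\<not> sepr (S - {x})"
      using min by fastforce
    then have "(u, v) \<in> (R (W - (S - {x})))\<^sup>*"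
      using S by (auto simp: sepr_def)
    then have "(z, z') \<in> (R (W - (S - {x})))\<^sup>*"
      using that(2) sym unfolding z'_def by auto
    then have "z' \<in> comp z"
    proof (induction rule: rtrancl_induct)
      case (step y a)
      then have "a \<noteq> x" "{y, a} \<in> E" "a \<in> W - S"
        using none by (auto simp: R_def insert_commute)
      then show ?case
        using comp_closed[OF step.IH _ _ z(1)] by blast
    qed (rule comp_self)
    then show False
      using z by blast
  qed
  \<comment> \<open>The second part is everything outside \<open>S\<close> and the component of
    \<open>u\<close>, not just the component of \<open>v\<close>, so that the three sets cover
    \<open>W\<close>.\<close>
  show thesis
  proof (rule that[of "comp u" "W - S - comp u" S])
    show "W = comp u \<union> (W - S - comp u) \<union> S"
      using S comp_sub[OF uvS(1)] by (auto simp: sepr_def)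
    show "u \<in> comp u" "v \<in> W - S - comp u"
      using comp_self comp_disj uvS by auto
    show "comp u \<inter> (W - S - comp u) = {}" "comp u \<inter> S = {}" "(W - S - comp u) \<inter> S = {}"
      using comp_sub[OF uvS(1)] by auto
    show "{a, b} \<notin> E" if "a \<in> comp u" "b \<in> W - S - comp u" for a b
      using comp_closed[OF that(1) _ _ uvS(1)] that(2) by blast
    show "{x, y} \<in> E" if xy: "x \<in> S" "y \<in> S" "x \<noteq> y" for x y
    proof (rule chordal_common_neighbours_adjacent[OF chordal, of "comp u" "comp v"])
      show "comp u \<subseteq> V" "comp v \<subseteq> V" "x \<in> V" "y \<in> V"
        using comp_sub uvS W S xy by (auto simp: sepr_def)
      show "{a, b} \<notin> E" if "a \<in> comp u" "b \<in> comp v" for a b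
        using comp_closed[OF that(1) _ _ uvS(1), of b] that(2) comp_sub[OF uvS(2)] comp_disj by blast
      show "(a, b) \<in> {(a, b). a \<in> comp u \<and> b \<in> comp u \<and> {a, b} \<in> E}\<^sup>*" if "a \<in> comp u" "b \<in> comp u" for a b
        using comp_conn[OF that uvS(1)] unfolding R_def .
      show "(a, b) \<in> {(a, b). a \<in> comp v \<and> b \<in> comp v \<and> {a, b} \<in> E}\<^sup>*" if "a \<in> comp v" "b \<in> comp v" for a b
        using comp_conn[OF that uvS(2)] unfolding R_def .
      show "x \<notin> comp u \<union> comp v" "y \<notin> comp u \<union> comp v"
        using comp_sub uvS xy by auto
      show "\<exists>a\<in>comp u. {x, a} \<in> E" "\<exists>a\<in>comp u. {a, y} \<in> E" "\<exists>b\<in>comp v. {x, b} \<in> E" "\<exists>b\<in>comp v. {b, y} \<in> E"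
        using nbr[OF xy(1), of u] nbr[OF xy(2), of u] nbr[OF xy(1), of v] nbr[OF xy(2), of v]
        by (simp_all add: insert_commute)
    qed (use comp_disj xy in auto)
  qed
qed

text \<open>Across a clique separator, the Gram vectors of both sides are matched by an isometry.\<close>

lemma chordal_gram_completion_induced:
  assumes chordal: "chordal_graph V E" and sym: "\<And>i j. M i j = M j i"
    and psd: "\<And>K. K \<in> clique_complex V E \<Longrightarrow> psd_on K M" and W: "W \<subseteq> V"
  shows "\<exists>m v. \<forall>i\<in>W. \<forall>j\<in>W. i = j \<or> {i, j} \<in> E \<longrightarrow> M i j = dot m (v i) (v j)"
proof -
  have "finite W"
    using chordal W finite_subset unfolding chordal_graph_def simple_graph_def by auto
  then show ?thesis
    using W
  proof (induction W rule: finite_psubset_induct)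
    case (psubset W)
    show ?case
    proof (cases "\<forall>i\<in>W. \<forall>j\<in>W. i \<noteq> j \<longrightarrow> {i, j} \<in> E")
      case True
      then have "psd_on W M"
        using psubset.prems by (intro psd) (auto simp: clique_complex_def)
      then show ?thesis
        using psd_on_gram[of W M, OF psubset.hyps(1) sym] by blast
    next
      case False
      then obtain u v where uv: "u \<in> W" "v \<in> W" "u \<noteq> v" "{u, v} \<notin> E"
        by auto
      obtain A B S where ABS: "W = A \<union> B \<union> S" "u \<in> A" "v \<in> B" "A \<inter> B = {}" "A \<inter> S = {}" "B \<inter> S = {}"
        "\<And>a b. a \<in> A \<Longrightarrow> b \<in> B \<Longrightarrow> {a, b} \<notin> E"
        "\<And>x y. x \<in> S \<Longrightarrow> y \<in> S \<Longrightarrow> x \<noteq> y \<Longrightarrow> {x, y} \<in> E"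
        using chordal_clique_separator[OF chordal psubset.prems uv] by blast
      have IH: "\<exists>m v. \<forall>i\<in>X. \<forall>j\<in>X. i = j \<or> {i, j} \<in> E \<longrightarrow> M i j = dot m (v i) (v j)" if "X \<subset> W" for X
        using psubset.IH[OF that] psubset.prems that by (meson psubset_imp_subset subset_trans)
      have "A \<union> S \<subset> W" "B \<union> S \<subset> W"
        using ABS by auto
      from this[THEN IH] obtain m1 v1 m2 v2 where
        v1: "\<forall>i\<in>A \<union> S. \<forall>j\<in>A \<union> S. i = j \<or> {i, j} \<in> E \<longrightarrow> M i j = dot m1 (v1 i) (v1 j)" and
        v2: "\<forall>i\<in>B \<union> S. \<forall>j\<in>B \<union> S. i = j \<or> {i, j} \<in> E \<longrightarrow> M i j = dot m2 (v2 i) (v2 j)"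
        by blast
      \<comment> \<open>Both Gram representations are padded with zeros to a common
        dimension.\<close>
      define m where "m = max m1 m2"
      define w1 w2 where "w1 i a = (if a < m1 then v1 i a else 0)" and "w2 i a = (if a < m2 then v2 i a else 0)" for i a
      have "dot m (w1 i) (w1 j) = dot m1 (w1 i) (w1 j)" "dot m1 (w1 i) (w1 j) = dot m1 (v1 i) (v1 j)" for i j
        by (rule dot_mono_dim) (auto simp: m_def w1_def dot_def)
      then have "dot m (w1 i) (w1 j) = dot m1 (v1 i) (v1 j)" for i j
        by simp
      then have w1: "dot m (w1 i) (w1 j) = M i j" if "i \<in> A \<union> S" "j \<in> A \<union> S" "i = j \<or> {i, j} \<in> E" for i j
        using v1 that by metis
      have "dot m (w2 i) (w2 j) = dot m2 (w2 i) (w2 j)" "dot m2 (w2 i) (w2 j) = dot m2 (v2 i) (v2 j)" for i j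
        by (rule dot_mono_dim) (auto simp: m_def w2_def dot_def)
      then have "dot m (w2 i) (w2 j) = dot m2 (v2 i) (v2 j)" for i j
        by simp
      then have w2: "dot m (w2 i) (w2 j) = M i j" if "i \<in> B \<union> S" "j \<in> B \<union> S" "i = j \<or> {i, j} \<in> E" for i j
        using v2 that by metis
      \<comment> \<open>\<open>S\<close> is a clique, so all its entries are prescribed and both
        sides realise them.\<close>
      have "dot m (w2 s) (w2 t) = dot m (w1 s) (w1 t)" if "s \<in> S" "t \<in> S" for s t
      proof -
        have "s = t \<or> {s, t} \<in> E"
          using ABS(8)[OF that] by blast
        then show ?thesis
          using w1[of s t] w2[of s t] that by simp
      qed
      moreover have "finite S"
        using psubset.hyps ABS(1) by simp
      ultimately have "\<exists>T. isometry m T \<and> (\<forall>s\<in>S. \<forall>i<m. T (w2 s) i = w1 s i)"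
        by (intro isometry_extension)
      then obtain T where T: "isometry m T" "\<And>s i. s \<in> S \<Longrightarrow> i < m \<Longrightarrow> T (w2 s) i = w1 s i"
        by blast
      \<comment> \<open>On \<open>S\<close> the vectors of the first side are kept; below
        \<open>m\<close> they agree with \<open>T (w2 s)\<close>, so \<open>w\<close> is also right
        on \<open>B\<close> together with \<open>S\<close>.\<close>
      define w where "w i = (if i \<in> B then T (w2 i) else w1 i)" for i
      have BB: "dot m (w i) (w j) = M i j" if "i \<in> B" "j \<in> B \<union> S" "i = j \<or> {i, j} \<in> E" for i j
      proof -
        have "dot m (w i) (w j) = dot m (T (w2 i)) (T (w2 j))"
        proof (rule dot_cong)
          show "w i a = T (w2 i) a" for a
            using that(1) by (simp add: w_def)
          show "w j a = T (w2 j) a" if "a < m" for a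
            using \<open>j \<in> B \<union> S\<close> T(2)[OF _ that] by (cases "j \<in> B") (simp_all add: w_def)
        qed
        also have "\<dots> = M i j"
          unfolding isometry_dot[OF T(1)] using w2[OF _ that(2,3)] that(1) by simp
        finally show ?thesis .
      qed
      \<comment> \<open>No edge joins \<open>A\<close> and \<open>B\<close>, so every prescribed
        pair lies within one of the two sides, each taken with \<open>S\<close>.\<close>
      have near: "y \<in> B \<union> S" if "x \<in> B" "y \<in> W" "y = x \<or> {y, x} \<in> E" for x y
      proof -
        have "y \<notin> A"
          using that(1,3) ABS(4) ABS(7)[of y x] by blast
        then show ?thesis
          using that(2) ABS(1) by blast
      qed
      have "M i j = dot m (w i) (w j)" if ij: "i \<in> W" "j \<in> W" "i = j \<or> {i, j} \<in> E" for i j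
      proof -
        have ji: "j = i \<or> {j, i} \<in> E"
          using ij(3) by (auto simp: insert_commute)
        consider "i \<in> B" "j \<in> B \<union> S" | "j \<in> B" "i \<in> B \<union> S" | "i \<notin> B" "j \<notin> B"
          using ij(1,2,3) ji near[of i j] near[of j i] by blast
        then show ?thesis
        proof cases
          case 1
          then show ?thesis
            using BB ij(3) by simp
        next
          case 2
          then show ?thesis
            using BB[OF 2 ji] sym[of i j] by (simp add: dot_commute)
        next
          case 3
          then show ?thesis
            using w1[OF _ _ ij(3)] ij(1,2) ABS(1) by (simp add: w_def)
        qed
      qed
      then show ?thesis
        by blast
    qed
  qed
qed

section \<open>Quadratic forms in the Stanley--Reisner ring\<close>

definition mono_eval :: "('v \<Rightarrow>\<^sub>0 nat) \<Rightarrow> ('v \<Rightarrow> real) \<Rightarrow> real"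
  where "mono_eval m x = (\<Prod>i\<in>Poly_Mapping.keys m. x i ^ Poly_Mapping.lookup m i)"

definition mono_degree :: "('v \<Rightarrow>\<^sub>0 nat) \<Rightarrow> nat"
  where "mono_degree m = (\<Sum>i\<in>Poly_Mapping.keys m. Poly_Mapping.lookup m i)"

lemma mono_eval_add: "mono_eval (m + n) x = mono_eval m x * mono_eval n x"
proof -
  let ?K = "Poly_Mapping.keys m \<union> Poly_Mapping.keys n"
  have sup: "mono_eval l x = (\<Prod>i\<in>?K. x i ^ Poly_Mapping.lookup l i)" if "Poly_Mapping.keys l \<subseteq> ?K" for l
    unfolding mono_eval_def by (rule prod.mono_neutral_left) (use that in \<open>auto simp: in_keys_iff\<close>)
  show ?thesis
    by (simp add: sup[OF keys_add] sup lookup_add power_add prod.distrib)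
qed

lemma mono_eval_single: "mono_eval (Poly_Mapping.single i 1) x = x i"
  by (simp add: mono_eval_def)

lemma mono_degree_add: "mono_degree (m + n) = mono_degree m + mono_degree n"
  unfolding mono_degree_def by (rule setsum_keys_plus_distrib) auto

lemma mono_degree_single: "mono_degree (Poly_Mapping.single i 1) = 1"
  by (simp add: mono_degree_def)

text \<open>Every exponent on the support is at least 1, so there are at most two variables;
  \<open>i = j\<close> is the case of a square.\<close>

lemma mono_degree_two:
  assumes "mono_degree m = 2"
  obtains i j where "i \<in> Poly_Mapping.keys m" "j \<in> Poly_Mapping.keys m" "\<And>x. mono_eval m x = x i * x j"
proof -
  let ?K = "Poly_Mapping.keys m" and ?l = "Poly_Mapping.lookup m"
  have pos: "?l k \<ge> 1" if "k \<in> ?K" for k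
    using that by (simp add: in_keys_iff Suc_le_eq)
  have sub: "sum ?l A \<ge> card A" if "A \<subseteq> ?K" for A
    using sum_bounded_below[of A 1 ?l] pos that by auto
  have "?K \<noteq> {}"
    using assms unfolding mono_degree_def by (metis sum.empty zero_neq_numeral)
  then obtain i where i: "i \<in> ?K"
    by blast
  have sum_i: "?l i + sum ?l (?K - {i}) = 2"
    using assms i unfolding mono_degree_def by (simp add: sum.remove)
  show thesis
  proof (cases "?K = {i}")
    case True
    then show thesis
      using sum_i by (intro that[of i i]) (simp_all add: mono_eval_def power2_eq_square)
  next
    case False
    then obtain j where j: "j \<in> ?K - {i}"
      using i by auto
    have sum_j: "sum ?l (?K - {i}) = ?l j + sum ?l (?K - {i} - {j})"
      using j by (simp add: sum.remove)
    moreover have "?l j \<ge> 1"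
      using j pos by blast
    ultimately have ij: "?l i = 1" "?l j = 1" "sum ?l (?K - {i} - {j}) = 0"
      using sum_i pos[OF i] by linarith+
    have "card (?K - {i} - {j}) = 0"
      using sub[of "?K - {i} - {j}"] ij(3) by auto
    then have "?K - {i} - {j} = {}"
      by simp
    then have "?K = {i, j}"
      using i j by auto
    then show thesis
      using j ij by (intro that[of i j]) (auto simp: mono_eval_def)
  qed
qed

lemma mpoly_eval_alt:
  "mpoly_eval p x = (\<Sum>m\<in>Poly_Mapping.keys p. Poly_Mapping.lookup p m * mono_eval m x)"
  unfolding mpoly_eval_def mono_eval_def ..

lemma mpoly_eval_0 [simp]: "mpoly_eval 0 x = 0"
  by (simp add: mpoly_eval_alt)

lemma mpoly_eval_single: "mpoly_eval (Poly_Mapping.single m c) x = c * mono_eval m x"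
  by (simp add: mpoly_eval_alt)

lemma mpoly_eval_add: "mpoly_eval (p + q) x = mpoly_eval p x + mpoly_eval q x"
  unfolding mpoly_eval_alt by (rule setsum_keys_plus_distrib) (auto simp: algebra_simps)

lemma mpoly_eval_diff: "mpoly_eval (p - q) x = mpoly_eval p x - mpoly_eval q x"
  using mpoly_eval_add[of "p - q" q x] by simp

lemma mpoly_eval_uminus: "mpoly_eval (- p) x = - mpoly_eval p x"
  using mpoly_eval_diff[of 0 p x] by simp

lemma mpoly_eval_sum: "mpoly_eval (\<Sum>i\<in>I. p i) x = (\<Sum>i\<in>I. mpoly_eval (p i) x)"
  by (induction I rule: infinite_finite_induct) (simp_all add: mpoly_eval_add)

lemma sum_monomials: "(\<Sum>m\<in>Poly_Mapping.keys p. Poly_Mapping.single m (Poly_Mapping.lookup p m)) = p"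
proof (rule poly_mapping_eqI)
  fix k
  have "(\<Sum>m\<in>Poly_Mapping.keys p. Poly_Mapping.lookup p m when m = k) = Poly_Mapping.lookup p k"
    by (simp add: when_def in_keys_iff)
  then show "Poly_Mapping.lookup (\<Sum>m\<in>Poly_Mapping.keys p. Poly_Mapping.single m (Poly_Mapping.lookup p m)) k
      = Poly_Mapping.lookup p k"
    by (simp add: lookup_sum lookup_single)
qed

lemma mpoly_eval_mult: "mpoly_eval (p * q) x = mpoly_eval p x * mpoly_eval q x"
proof -
  let ?s = "\<lambda>p m. Poly_Mapping.single m (Poly_Mapping.lookup p m)"
  have "p * q = (\<Sum>m\<in>Poly_Mapping.keys p. \<Sum>n\<in>Poly_Mapping.keys q. ?s p m * ?s q n)"
    using sum_product[of "?s p" "Poly_Mapping.keys p" "?s q" "Poly_Mapping.keys q"]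
    by (simp add: sum_monomials)
  then have "mpoly_eval (p * q) x = (\<Sum>m\<in>Poly_Mapping.keys p. \<Sum>n\<in>Poly_Mapping.keys q.
      (Poly_Mapping.lookup p m * mono_eval m x) * (Poly_Mapping.lookup q n * mono_eval n x))"
    by (simp add: mpoly_eval_sum mult_single mpoly_eval_single mono_eval_add mult_ac)
  then show ?thesis
    by (simp add: mpoly_eval_alt sum_product)
qed

lemma mpoly_eval_Const: "mpoly_eval (Const c) x = c"
  by (simp add: Const_def mpoly_eval_single mono_eval_def)

lemma mpoly_eval_Var: "mpoly_eval (Var i) x = x i"
  unfolding Var_def mpoly_eval_single mono_eval_single by simp

lemma mpoly_eval_prod: "mpoly_eval (\<Prod>i\<in>I. p i) x = (\<Prod>i\<in>I. mpoly_eval (p i) x)"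
proof -
  have "mpoly_eval 1 x = 1"
    using mpoly_eval_single[of 0 1 x] by (simp add: mono_eval_def)
  then show ?thesis
    by (induction I rule: infinite_finite_induct) (simp_all add: mpoly_eval_mult)
qed

section \<open>The polynomial ring and the Stanley-Reisner ideal\<close>

lemma mpoly_ring_simps [simp]:
  "p \<in> carrier (mpoly_ring V) \<longleftrightarrow> (\<forall>m\<in>Poly_Mapping.keys p. Poly_Mapping.keys m \<subseteq> V)"
  "p \<otimes>\<^bsub>mpoly_ring V\<^esub> q = p * q" "\<one>\<^bsub>mpoly_ring V\<^esub> = 1"
  "\<zero>\<^bsub>mpoly_ring V\<^esub> = 0" "p \<oplus>\<^bsub>mpoly_ring V\<^esub> q = p + q"
  by (simp_all add: mpoly_ring_def)

lemma mpoly_ring_closed: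
  assumes "p \<in> carrier (mpoly_ring V)" "q \<in> carrier (mpoly_ring V)"
  shows "p + q \<in> carrier (mpoly_ring V)" "p * q \<in> carrier (mpoly_ring V)"
    "- p \<in> carrier (mpoly_ring V)" "p - q \<in> carrier (mpoly_ring V)"
proof -
  show "p + q \<in> carrier (mpoly_ring V)"
    using assms keys_add[of p q] by fastforce
  show "p * q \<in> carrier (mpoly_ring V)"
  proof (unfold mpoly_ring_simps(1), rule ballI)
    fix m assume "m \<in> Poly_Mapping.keys (p * q)"
    then obtain a b where "m = a + b" "a \<in> Poly_Mapping.keys p" "b \<in> Poly_Mapping.keys q"
      using keys_mult[of p q] by auto
    then show "Poly_Mapping.keys m \<subseteq> V"
      using assms keys_add[of a b] by fastforce
  qed
  show "- p \<in> carrier (mpoly_ring V)"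
    using assms(1) by (simp add: in_keys_iff)
  have "Poly_Mapping.keys (p - q) \<subseteq> Poly_Mapping.keys p \<union> Poly_Mapping.keys q"
    by (auto simp: in_keys_iff lookup_minus)
  then show "p - q \<in> carrier (mpoly_ring V)"
    using assms by fastforce
qed

lemma mpoly_ring_sum_closed:
  "(\<And>i. i \<in> I \<Longrightarrow> p i \<in> carrier (mpoly_ring V)) \<Longrightarrow> (\<Sum>i\<in>I. p i) \<in> carrier (mpoly_ring V)"
  by (induction I rule: infinite_finite_induct)
    (auto simp del: mpoly_ring_simps(1) intro: mpoly_ring_closed, simp_all)

lemma Const_in_mpoly_ring: "Const c \<in> carrier (mpoly_ring V)"
  by (simp add: Const_def)

lemma cring_mpoly_ring: "cring (mpoly_ring V)"
proof (rule cringI)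
  show "abelian_group (mpoly_ring V)"
  proof (rule abelian_groupI)
    show "\<exists>y\<in>carrier (mpoly_ring V). y \<oplus>\<^bsub>mpoly_ring V\<^esub> x = \<zero>\<^bsub>mpoly_ring V\<^esub>"
      if "x \<in> carrier (mpoly_ring V)" for x
      using mpoly_ring_closed(3)[OF that that] by (intro bexI[of _ "- x"]) (simp_all del: mpoly_ring_simps(1))
  qed (simp_all del: mpoly_ring_simps(1) add: mpoly_ring_closed add.assoc add.commute, simp)
  show "comm_monoid (mpoly_ring V)"
    by (rule comm_monoidI)
      (simp_all del: mpoly_ring_simps(1) add: mpoly_ring_closed mult.assoc mult.commute, simp)
qed (simp add: distrib_right)

definition complex_support :: "'v set set \<Rightarrow> ('v \<Rightarrow> real) set"
  where "complex_support \<Delta> = (\<Union>F\<in>\<Delta>. coord_space F)"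

text \<open>Lets minimality of the generated ideal bound \<open>SR_ideal\<close> from above, so its
  elements need no explicit description.\<close>

lemma ideal_vanishing:
  "ideal {p \<in> carrier (mpoly_ring V). \<forall>x\<in>U. mpoly_eval p x = 0} (mpoly_ring V)" (is "ideal ?I _")
proof -
  interpret cring "mpoly_ring V"
    by (rule cring_mpoly_ring)
  show ?thesis
  proof (rule idealI)
    show "ring (mpoly_ring V)"
      by (rule ring_axioms)
    show "subgroup ?I (add_monoid (mpoly_ring V))"
    proof (rule add.subgroupI)
      show "?I \<noteq> {}"
      proof -
        have "0 \<in> ?I"
          by simp
        then show ?thesis
          by blast
      qed
      show "\<ominus>\<^bsub>mpoly_ring V\<^esub> p \<in> ?I" if "p \<in> ?I" for p
      proof -
        have "- p \<in> carrier (mpoly_ring V)"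
          using that by (intro mpoly_ring_closed) auto
        moreover from this have "\<ominus>\<^bsub>mpoly_ring V\<^esub> p = - p"
          using that by (intro minus_equality) (simp_all del: mpoly_ring_simps(1))
        ultimately show ?thesis
          using that by (simp del: mpoly_ring_simps(1) add: mpoly_eval_uminus)
      qed
      show "p \<oplus>\<^bsub>mpoly_ring V\<^esub> q \<in> ?I" if "p \<in> ?I" "q \<in> ?I" for p q
        using that by (simp del: mpoly_ring_simps(1) add: mpoly_ring_closed mpoly_eval_add)
    qed auto
  qed (simp_all del: mpoly_ring_simps(1) add: mpoly_ring_closed mpoly_eval_mult)
qed

lemma SR_generators_closed:
  "{\<Prod>i\<in>S. Var i | S. S \<subseteq> V \<and> S \<notin> \<Delta>} \<subseteq> carrier (mpoly_ring V)"
proof -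
  have "(\<Prod>i\<in>S. Var i) \<in> carrier (mpoly_ring V)" if "S \<subseteq> V" for S
    using that
  proof (induction S rule: infinite_finite_induct)
    case (insert i S)
    moreover have "Var i \<in> carrier (mpoly_ring V)"
      using insert by (simp add: Var_def)
    ultimately show ?case
      by (simp del: mpoly_ring_simps(1) add: mpoly_ring_closed)
  qed simp_all
  then show ?thesis
    by blast
qed

lemma SR_ideal_ideal: "ideal (SR_ideal \<Delta>) (mpoly_ring (vertices \<Delta>))"
proof -
  interpret cring "mpoly_ring (vertices \<Delta>)"
    by (rule cring_mpoly_ring)
  show ?thesis
    unfolding SR_ideal_def by (rule genideal_ideal[OF SR_generators_closed])
qed

text \<open>A non-face is contained in no face \<open>F\<close>, so its monomial has a variable that
  vanishes on \<open>coord_space F\<close>.\<close>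

lemma SR_ideal_vanishes:
  assumes \<Delta>: "simplicial_complex \<Delta>" and x: "x \<in> complex_support \<Delta>" and p: "p \<in> SR_ideal \<Delta>"
  shows "mpoly_eval p x = 0"
proof -
  interpret cring "mpoly_ring (vertices \<Delta>)"
    by (rule cring_mpoly_ring)
  have "mpoly_eval (\<Prod>i\<in>S. Var i) y = 0"
    if S: "S \<subseteq> vertices \<Delta>" "S \<notin> \<Delta>" and y: "y \<in> complex_support \<Delta>" for S y
  proof -
    obtain F where F: "F \<in> \<Delta>" "y \<in> coord_space F"
      using y by (auto simp: complex_support_def)
    then obtain i where "i \<in> S" "i \<notin> F"
      using S \<Delta> unfolding simplicial_complex_def by blast
    moreover have "finite S"
      using S \<Delta> finite_subset unfolding simplicial_complex_def by auto
    ultimately show ?thesis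
      using F by (auto simp: mpoly_eval_prod mpoly_eval_Var coord_space_def intro!: prod_zero)
  qed
  then have "SR_ideal \<Delta> \<subseteq> {p \<in> carrier (mpoly_ring (vertices \<Delta>)). \<forall>x\<in>complex_support \<Delta>. mpoly_eval p x = 0}"
    unfolding SR_ideal_def using SR_generators_closed
    by (intro genideal_minimal ideal_vanishing) blast
  then show ?thesis
    using p x by auto
qed

lemma SR_class_hom: "SR_class \<Delta> \<in> Ring.ring_hom (mpoly_ring (vertices \<Delta>)) (SR_ring \<Delta>)"
  using ideal.rcos_ring_hom[OF SR_ideal_ideal] unfolding SR_class_def[abs_def] SR_ring_def .

lemma ring_SR_ring: "ring (SR_ring \<Delta>)"
  using ideal.quotient_is_ring[OF SR_ideal_ideal] unfolding SR_ring_def .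

lemma SR_class_self:
  assumes "p \<in> carrier (mpoly_ring (vertices \<Delta>))"
  shows "p \<in> SR_class \<Delta> p"
proof -
  interpret ideal "SR_ideal \<Delta>" "mpoly_ring (vertices \<Delta>)"
    by (rule SR_ideal_ideal)
  show ?thesis
    unfolding SR_class_def using assms by (rule a_rcos_self)
qed

lemma SR_eval_class:
  assumes "simplicial_complex \<Delta>" "p \<in> carrier (mpoly_ring (vertices \<Delta>))" "x \<in> complex_support \<Delta>"
  shows "SR_eval (SR_class \<Delta> p) x = mpoly_eval p x"
proof -
  have "mpoly_eval q x = mpoly_eval p x" if q: "q \<in> SR_class \<Delta> p" for q
  proof -
    obtain h where "h \<in> SR_ideal \<Delta>" "q = h + p"
      using q unfolding SR_class_def a_r_coset_def' by auto
    then show ?thesis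
      using SR_ideal_vanishes[OF assms(1,3)] by (simp add: mpoly_eval_add)
  qed
  then have "(\<lambda>q. mpoly_eval q x) ` SR_class \<Delta> p = (\<lambda>q. mpoly_eval p x) ` SR_class \<Delta> p"
    by (rule image_cong[OF refl])
  also have "\<dots> = {mpoly_eval p x}"
    using SR_class_self[OF assms(2)] by (rule image_constant)
  finally have "(\<lambda>q. mpoly_eval q x) ` SR_class \<Delta> p = {mpoly_eval p x}" .
  then show ?thesis
    unfolding SR_eval_def by simp
qed

lemma SR_class_eq_zero:
  assumes "simplicial_complex \<Delta>" "p \<in> carrier (mpoly_ring (vertices \<Delta>))" "x \<in> complex_support \<Delta>"
    "SR_class \<Delta> p = \<zero>\<^bsub>SR_ring \<Delta>\<^esub>"
  shows "mpoly_eval p x = 0"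
  using SR_class_self[OF assms(2)] SR_ideal_vanishes[OF assms(1,3)] assms(4)
  by (simp add: SR_ring_def FactRing_def)

text \<open>\<open>li_Cons\<close> would make the pair independent unless the class of
  \<open>q\<close> is zero or the class of \<open>p\<close> lies in its span. The outcome is stated
  for values on the complex, where forms are compared afterwards.\<close>

lemma SR_dependent_pair:
  assumes \<Delta>: "simplicial_complex \<Delta>"
    and p: "p \<in> carrier (mpoly_ring (vertices \<Delta>))" and q: "q \<in> carrier (mpoly_ring (vertices \<Delta>))"
    and dep: "\<not> ring.independent (SR_ring \<Delta>) (SR_scalars \<Delta>) [SR_class \<Delta> p, SR_class \<Delta> q]"
  obtains c where "\<And>x. x \<in> complex_support \<Delta> \<Longrightarrow> mpoly_eval p x = c * mpoly_eval q x"
  | "\<And>x. x \<in> complex_support \<Delta> \<Longrightarrow> mpoly_eval q x = 0"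
proof -
  interpret ring "SR_ring \<Delta>"
    by (rule ring_SR_ring)
  have carr: "SR_class \<Delta> r \<in> carrier (SR_ring \<Delta>)" if "r \<in> carrier (mpoly_ring (vertices \<Delta>))" for r
    using ring_hom_closed[OF SR_class_hom that] .
  have "SR_class \<Delta> q = \<zero>\<^bsub>SR_ring \<Delta>\<^esub> \<or> SR_class \<Delta> p \<in> Span (SR_scalars \<Delta>) [SR_class \<Delta> q]"
  proof (rule ccontr)
    assume *: "\<not> (SR_class \<Delta> q = \<zero>\<^bsub>SR_ring \<Delta>\<^esub> \<or> SR_class \<Delta> p \<in> Span (SR_scalars \<Delta>) [SR_class \<Delta> q])"
    have "independent (SR_scalars \<Delta>) [SR_class \<Delta> q]"
      using carr[OF q] * by (intro li_Cons) auto
    then have "independent (SR_scalars \<Delta>) [SR_class \<Delta> p, SR_class \<Delta> q]"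
      using li_Cons[OF carr[OF p]] * by blast
    then show False
      using dep by blast
  qed
  then show thesis
  proof
    assume "SR_class \<Delta> q = \<zero>\<^bsub>SR_ring \<Delta>\<^esub>"
    then show thesis
      using SR_class_eq_zero[OF \<Delta> q] by (intro that(2))
  next
    assume "SR_class \<Delta> p \<in> Span (SR_scalars \<Delta>) [SR_class \<Delta> q]"
    \<comment> \<open>The span of a one-element list extends the span of the empty list, hence the
      zero summand.\<close>
    then obtain c where c: "SR_class \<Delta> p
        = (SR_class \<Delta> (Const c) \<otimes>\<^bsub>SR_ring \<Delta>\<^esub> SR_class \<Delta> q) \<oplus>\<^bsub>SR_ring \<Delta>\<^esub> \<zero>\<^bsub>SR_ring \<Delta>\<^esub>"
      by (auto simp: line_extension_def set_add_def' r_coset_def SR_scalars_def)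
    have "SR_class \<Delta> (Const c) \<otimes>\<^bsub>SR_ring \<Delta>\<^esub> SR_class \<Delta> q = SR_class \<Delta> (Const c * q)"
      using ring_hom_mult[OF SR_class_hom Const_in_mpoly_ring q, of c] by simp
    then have eq: "SR_class \<Delta> p = SR_class \<Delta> (Const c * q)"
      using c carr[OF mpoly_ring_closed(2)[OF Const_in_mpoly_ring q]] by simp
    have "mpoly_eval p x = c * mpoly_eval q x" if "x \<in> complex_support \<Delta>" for x
      using SR_eval_class[OF \<Delta> p that] SR_eval_class[OF \<Delta> mpoly_ring_closed(2)[OF Const_in_mpoly_ring q] that, of c]
      by (simp add: eq mpoly_eval_mult mpoly_eval_Const)
    then show thesis
      by (rule that(1))
  qed
qed

section \<open>Quadratic forms as matrices\<close>

lemma form_coord_space: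
  assumes "finite V" "F \<subseteq> V" "x \<in> coord_space F"
  shows "form V M x = form F M x"
proof -
  have x: "x i = 0" if "i \<notin> F" for i
    using assms(3) that by (simp add: coord_space_def)
  have "(\<Sum>i\<in>V. \<Sum>j\<in>V. M i j * x i * x j) = (\<Sum>i\<in>F. \<Sum>j\<in>V. M i j * x i * x j)"
    by (rule sum.mono_neutral_right) (use assms x in auto)
  also have "\<dots> = (\<Sum>i\<in>F. \<Sum>j\<in>F. M i j * x i * x j)"
    by (intro sum.cong refl sum.mono_neutral_right) (use assms x in auto)
  finally show ?thesis
    unfolding form_def .
qed

lemma homogeneous_alt: "homogeneous d p \<longleftrightarrow> (\<forall>m\<in>Poly_Mapping.keys p. mono_degree m = d)"
  by (simp add: homogeneous_def mono_degree_def)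

lemma homogeneous_diff: "homogeneous d p \<Longrightarrow> homogeneous d q \<Longrightarrow> homogeneous d (p - q)"
  unfolding homogeneous_alt by (auto simp: in_keys_iff lookup_minus)

lemma homogeneous_sum: "(\<And>i. i \<in> I \<Longrightarrow> homogeneous d (p i)) \<Longrightarrow> homogeneous d (\<Sum>i\<in>I. p i)"
proof (induction I rule: infinite_finite_induct)
  case (insert i I)
  then show ?case
    using keys_add[of "p i" "\<Sum>i\<in>I. p i"] unfolding homogeneous_alt by (auto simp: subset_iff)
qed (simp_all add: homogeneous_alt)

definition form_poly :: "'v set \<Rightarrow> ('v \<Rightarrow> 'v \<Rightarrow> real) \<Rightarrow> 'v real_mpoly"
  where "form_poly V M = (\<Sum>i\<in>V. \<Sum>j\<in>V.
    Poly_Mapping.single (Poly_Mapping.single i 1 + Poly_Mapping.single j 1) (M i j))"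

lemma form_poly_closed: "form_poly V M \<in> carrier (mpoly_ring V)"
  unfolding form_poly_def
proof (intro mpoly_ring_sum_closed)
  fix i j assume ij: "i \<in> V" "j \<in> V"
  have "Poly_Mapping.keys (Poly_Mapping.single i 1 + Poly_Mapping.single j (1::nat)) \<subseteq> {i} \<union> {j}"
    using keys_add[of "Poly_Mapping.single i (1::nat)" "Poly_Mapping.single j 1"] by simp
  then show "Poly_Mapping.single (Poly_Mapping.single i 1 + Poly_Mapping.single j 1) (M i j) \<in> carrier (mpoly_ring V)"
    using ij by auto
qed

lemma form_poly_homogeneous: "homogeneous 2 (form_poly V M)"
  unfolding form_poly_def
  by (intro homogeneous_sum) (simp add: homogeneous_alt mono_degree_add mono_degree_single del: One_nat_def)

lemma form_poly_eval: "mpoly_eval (form_poly V M) x = form V M x"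
  unfolding form_poly_def form_def mpoly_eval_sum mpoly_eval_single mono_eval_add mono_eval_single
  by (simp add: mult.assoc)

lemma quadratic_form_matrix:
  assumes V: "finite V" and p: "p \<in> carrier (mpoly_ring V)" "homogeneous 2 p"
  shows "\<exists>M. (\<forall>i j. M i j = M j i) \<and> (\<forall>x. mpoly_eval p x = form V M x)"
proof -
  have "\<exists>i j. i \<in> V \<and> j \<in> V \<and> (\<forall>x. mono_eval m x = x i * x j)" if m: "m \<in> Poly_Mapping.keys p" for m
  proof -
    have "mono_degree m = 2" "Poly_Mapping.keys m \<subseteq> V"
      using p m by (auto simp: homogeneous_alt)
    then show ?thesis
      by (metis mono_degree_two subsetD)
  qed
  then obtain a b where ab: "\<And>m. m \<in> Poly_Mapping.keys p \<Longrightarrow> a m \<in> V \<and> b m \<in> V"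
    "\<And>m x. m \<in> Poly_Mapping.keys p \<Longrightarrow> mono_eval m x = x (a m) * x (b m)"
    by metis
  \<comment> \<open>The symmetric matrix of a single monomial. For \<open>a m = b m\<close> both
    indicators hold at the same diagonal entry, so the factor 1/2 is right there too.\<close>
  define N where "N m i j = (of_bool (i = a m \<and> j = b m) + of_bool (j = a m \<and> i = b m)) / (2::real)" for m i j
  define M where "M i j = (\<Sum>m\<in>Poly_Mapping.keys p. Poly_Mapping.lookup p m * N m i j)" for i j
  have N: "form V (N m) x = mono_eval m x" if "m \<in> Poly_Mapping.keys p" for m x
  proof -
    have E: "(\<Sum>i\<in>V. \<Sum>j\<in>V. of_bool (i = k \<and> j = l) * x i * x j) = x k * x l" if "k \<in> V" "l \<in> V" for k l
    proof -
      have "(\<Sum>i\<in>V. \<Sum>j\<in>V. of_bool (i = k \<and> j = l) * x i * x j)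
          = (\<Sum>i\<in>V. if i = k then (\<Sum>j\<in>V. if j = l then x k * x l else 0) else 0)"
        by (auto intro!: sum.cong)
      then show ?thesis
        using V that by simp
    qed
    have "form V (N m) x = ((\<Sum>i\<in>V. \<Sum>j\<in>V. of_bool (i = a m \<and> j = b m) * x i * x j)
        + (\<Sum>i\<in>V. \<Sum>j\<in>V. of_bool (i = b m \<and> j = a m) * x i * x j)) / 2"
      unfolding form_def N_def sum.distrib[symmetric] sum_divide_distrib
      by (intro sum.cong refl) (auto simp: field_simps)
    then show ?thesis
      using ab[OF that] by (simp add: E)
  qed
  have "mpoly_eval p x = form V M x" for x
  proof -
    have "mpoly_eval p x = (\<Sum>m\<in>Poly_Mapping.keys p. Poly_Mapping.lookup p m * form V (N m) x)"
      unfolding mpoly_eval_alt by (intro sum.cong refl) (simp add: N)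
    also have "\<dots> = (\<Sum>i\<in>V. \<Sum>m\<in>Poly_Mapping.keys p. \<Sum>j\<in>V. Poly_Mapping.lookup p m * (N m i j * x i * x j))"
      unfolding form_def sum_distrib_left by (rule sum.swap)
    also have "\<dots> = (\<Sum>i\<in>V. \<Sum>j\<in>V. \<Sum>m\<in>Poly_Mapping.keys p. Poly_Mapping.lookup p m * (N m i j * x i * x j))"
      by (rule sum.cong[OF refl]) (rule sum.swap)
    also have "\<dots> = form V M x"
      unfolding form_def M_def sum_distrib_right by (simp add: mult.assoc)
    finally show ?thesis .
  qed
  moreover have "M i j = M j i" for i j
    unfolding M_def N_def by (intro sum.cong refl) auto
  ultimately show ?thesis
    by blast
qed

text \<open>Only the entries at pairs within a common face are determined by \<open>q\<close>; they
  form the partial matrix to be completed.\<close>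

lemma nonneg_form_matrix:
  assumes \<Delta>: "simplicial_complex \<Delta>" and q: "q \<in> nonneg_forms \<Delta>"
  obtains M where "\<And>i j. M i j = M j i"
    "\<And>F x. F \<in> \<Delta> \<Longrightarrow> x \<in> coord_space F \<Longrightarrow> SR_eval q x = form F M x"
    "\<And>F x. F \<in> \<Delta> \<Longrightarrow> form F M x \<ge> 0"
proof -
  have V: "finite (vertices \<Delta>)"
    using \<Delta> by (simp add: simplicial_complex_def)
  obtain p where p: "p \<in> carrier (mpoly_ring (vertices \<Delta>))" "homogeneous 2 p" "q = SR_class \<Delta> p"
    using q by (auto simp: nonneg_forms_def SR_part_def simp del: mpoly_ring_simps(1))
  obtain M where M: "\<And>i j. M i j = M j i" "\<And>x. mpoly_eval p x = form (vertices \<Delta>) M x"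
    using quadratic_form_matrix[OF V p(1,2)] by blast
  have eval: "SR_eval q x = form F M x" if "F \<in> \<Delta>" "x \<in> coord_space F" for F x
  proof -
    have "SR_eval q x = form (vertices \<Delta>) M x"
      unfolding p(3) M(2)[symmetric] using that by (intro SR_eval_class \<Delta> p(1)) (auto simp: complex_support_def)
    then show ?thesis
      using form_coord_space[OF V _ that(2), of M] that(1) by auto
  qed
  have "form F M x \<ge> 0" if "F \<in> \<Delta>" for F x
  proof -
    \<comment> \<open>The form on \<open>F\<close> reads only the values on \<open>F\<close>, so
      \<open>x\<close> may be cut off outside \<open>F\<close>.\<close>
    define y where "y i = (if i \<in> F then x i else 0)" for i
    have y: "y \<in> coord_space F"
      by (simp add: y_def coord_space_def)
    have "form F M x = form F M y"
      by (simp add: form_def y_def)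
    also have "\<dots> = SR_eval q y"
      using eval[OF that y] by simp
    also have "\<dots> \<ge> 0"
      using q y that by (auto simp: nonneg_forms_def)
    finally show ?thesis .
  qed
  then show thesis
    using that M(1) eval by blast
qed

text \<open>\<open>q\<close> is the sum of the form of \<open>Y\<close> and a remainder, both
  nonnegative by domination, so extremality makes them dependent. Positivity at \<open>x0\<close>
  excludes a degenerate relation and fixes the sign of \<open>C\<close>.\<close>

lemma extreme_ray_dominated_form:
  assumes \<Delta>: "simplicial_complex \<Delta>" and q: "spans_extreme_ray \<Delta> (nonneg_forms \<Delta>) q"
    and Y: "\<And>F x. F \<in> \<Delta> \<Longrightarrow> x \<in> coord_space F \<Longrightarrow> 0 \<le> form F Y x \<and> form F Y x \<le> SR_eval q x"
    and pos: "F0 \<in> \<Delta>" "x0 \<in> coord_space F0" "form F0 Y x0 > 0"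
  obtains C where "C \<ge> 0" "\<And>F x. F \<in> \<Delta> \<Longrightarrow> x \<in> coord_space F \<Longrightarrow> SR_eval q x = C * form F Y x"
proof -
  have V: "finite (vertices \<Delta>)"
    using \<Delta> by (simp add: simplicial_complex_def)
  have qP: "q \<in> nonneg_forms \<Delta>"
    using q by (simp add: spans_extreme_ray_def)
  then obtain p where p: "p \<in> carrier (mpoly_ring (vertices \<Delta>))" "homogeneous 2 p" "q = SR_class \<Delta> p"
    by (auto simp: nonneg_forms_def SR_part_def simp del: mpoly_ring_simps(1))
  define py where "py = form_poly (vertices \<Delta>) Y"
  define pz where "pz = p - py"
  have py: "py \<in> carrier (mpoly_ring (vertices \<Delta>))" "homogeneous 2 py"
    unfolding py_def by (rule form_poly_closed form_poly_homogeneous)+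
  have pz: "pz \<in> carrier (mpoly_ring (vertices \<Delta>))" "homogeneous 2 pz"
    unfolding pz_def using p py by (auto intro: mpoly_ring_closed homogeneous_diff simp del: mpoly_ring_simps(1))
  have supp: "x \<in> complex_support \<Delta>" if "F \<in> \<Delta>" "x \<in> coord_space F" for F x
    using that by (auto simp: complex_support_def)
  have eval_y: "mpoly_eval py x = form F Y x" if "F \<in> \<Delta>" "x \<in> coord_space F" for F x
    unfolding py_def form_poly_eval using form_coord_space[OF V _ that(2)] that(1) by blast
  have eval_p: "mpoly_eval p x = SR_eval q x" if "F \<in> \<Delta>" "x \<in> coord_space F" for F x
    unfolding p(3) using SR_eval_class[OF \<Delta> p(1) supp[OF that]] by simp
  have eval_z: "mpoly_eval pz x = SR_eval q x - form F Y x" if "F \<in> \<Delta>" "x \<in> coord_space F" for F x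
    unfolding pz_def mpoly_eval_diff eval_y[OF that] eval_p[OF that] ..
  have in_P: "SR_class \<Delta> r \<in> nonneg_forms \<Delta>"
    if r: "r \<in> carrier (mpoly_ring (vertices \<Delta>))" "homogeneous 2 r"
      and nonneg: "\<And>F x. F \<in> \<Delta> \<Longrightarrow> x \<in> coord_space F \<Longrightarrow> mpoly_eval r x \<ge> 0" for r
    using r nonneg SR_eval_class[OF \<Delta> r(1) supp]
    by (auto simp: nonneg_forms_def SR_part_def simp del: mpoly_ring_simps(1))
  have "q = SR_class \<Delta> (py + pz)"
    by (simp add: pz_def p(3))
  also have "\<dots> = SR_class \<Delta> py \<oplus>\<^bsub>SR_ring \<Delta>\<^esub> SR_class \<Delta> pz"
    using ring_hom_add[OF SR_class_hom py(1) pz(1)] by simp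
  finally have q_sum: "q = SR_class \<Delta> py \<oplus>\<^bsub>SR_ring \<Delta>\<^esub> SR_class \<Delta> pz" .
  moreover have "SR_class \<Delta> py \<in> nonneg_forms \<Delta>" "SR_class \<Delta> pz \<in> nonneg_forms \<Delta>"
    using Y py pz eval_y eval_z by (auto intro!: in_P simp del: mpoly_ring_simps(1))
  ultimately have "\<not> ring.independent (SR_ring \<Delta>) (SR_scalars \<Delta>) [SR_class \<Delta> py, SR_class \<Delta> pz]"
    using q unfolding spans_extreme_ray_def by blast
  from SR_dependent_pair[OF \<Delta> py(1) pz(1) this]
  have "\<exists>C. \<forall>F\<in>\<Delta>. \<forall>x\<in>coord_space F. SR_eval q x = C * form F Y x"
  proof cases
    case (1 c)
    have eq: "form F Y x = c * (SR_eval q x - form F Y x)" if "F \<in> \<Delta>" "x \<in> coord_space F" for F x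
      using 1[OF supp[OF that]] eval_y[OF that] eval_z[OF that] by simp
    \<comment> \<open>With \<open>c = 0\<close> the form of \<open>Y\<close> would vanish on all
      faces, against \<open>pos\<close>; otherwise the relation can be solved for
      \<open>q\<close>.\<close>
    then have "c \<noteq> 0"
      using pos by fastforce
    then have "SR_eval q x = (1 + 1 / c) * form F Y x" if "F \<in> \<Delta>" "x \<in> coord_space F" for F x
      using eq[OF that] by (simp add: field_simps)
    then show ?thesis
      by blast
  next
    case 2
    then have "SR_eval q x = 1 * form F Y x" if "F \<in> \<Delta>" "x \<in> coord_space F" for F x
      using 2[OF supp[OF that]] eval_z[OF that] by simp
    then show ?thesis
      by blast
  qed
  then obtain C where C: "\<And>F x. F \<in> \<Delta> \<Longrightarrow> x \<in> coord_space F \<Longrightarrow> SR_eval q x = C * form F Y x"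
    by blast
  have "0 \<le> C * form F0 Y x0"
    using C[OF pos(1,2)] Y[OF pos(1,2)] by linarith
  then have "C \<ge> 0"
    using pos(3) by (simp add: zero_le_mult_iff)
  then show thesis
    using C by (rule that)
qed

section \<open>Gluing two distant faces\<close>

lemma form_image:
  assumes "inj_on h F"
  shows "form (h ` F) M x = form F (\<lambda>i j. M (h i) (h j)) (\<lambda>i. x (h i))"
  by (simp add: form_def sum.reindex[OF assms])

lemma psd_on_comp:
  assumes inj: "inj_on h F" and nonneg: "\<And>x. 0 \<le> form (h ` F) M x"
  shows "psd_on F (\<lambda>i j. M (h i) (h j))"
  unfolding psd_on_def
proof
  fix x
  have "form F (\<lambda>i j. M (h i) (h j)) x = form F (\<lambda>i j. M (h i) (h j)) (\<lambda>i. x (inv_into F h (h i)))"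
    unfolding form_def by (intro sum.cong refl) (simp add: inv_into_f_f[OF inj])
  also have "\<dots> = form (h ` F) M (\<lambda>c. x (inv_into F h c))"
    unfolding form_image[OF inj] ..
  finally show "0 \<le> form F (\<lambda>i j. M (h i) (h j)) x"
    using nonneg by simp
qed

lemma form_cong: "(\<And>i j. i \<in> F \<Longrightarrow> j \<in> F \<Longrightarrow> M i j = N i j) \<Longrightarrow> form F M x = form F N x"
  unfolding form_def by (intro sum.cong refl) simp

lemma form_gram:
  "form F (\<lambda>i j. dot m (v i) (v j)) x = dot m (\<lambda>a. \<Sum>i\<in>F. x i * v i a) (\<lambda>a. \<Sum>i\<in>F. x i * v i a)"
proof -
  have "dot m (\<lambda>a. \<Sum>i\<in>F. x i * v i a) (\<lambda>a. \<Sum>j\<in>F. x j * v j a)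
      = (\<Sum>i\<in>F. x i * (\<Sum>j\<in>F. x j * dot m (v j) (v i)))"
    unfolding dot_sum by (simp add: dot_commute[of m "v _" "\<lambda>a. \<Sum>j\<in>F. x j * v j a"] dot_sum)
  also have "\<dots> = form F (\<lambda>i j. dot m (v i) (v j)) x"
    unfolding form_def sum_distrib_left by (intro sum.cong refl) (simp add: dot_commute mult_ac)
  finally show ?thesis ..
qed

lemma form_two_squares:
  "form F (\<lambda>i j. e * (A i * A j + B i * B j)) x = e * ((\<Sum>i\<in>F. A i * x i)\<^sup>2 + (\<Sum>i\<in>F. B i * x i)\<^sup>2)"
proof -
  have "(\<Sum>i\<in>F. h i * x i)\<^sup>2 = (\<Sum>i\<in>F. \<Sum>j\<in>F. h i * h j * x i * x j)" for h
    unfolding power2_eq_square sum_product by (simp add: mult_ac)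
  then show ?thesis
    by (simp add: form_def sum_distrib_left sum.distrib algebra_simps)
qed

lemma form_rank_le:
  "(\<And>x. x \<in> coord_space F \<Longrightarrow> g x = (\<Sum>j<m. (\<Sum>i\<in>F. a j i * x i)\<^sup>2)) \<Longrightarrow> form_rank F g \<le> m"
  unfolding form_rank_def by (rule Least_le) blast

lemma simplicial_complex_quotient:
  assumes "simplicial_complex \<Gamma>"
  shows "simplicial_complex (quotient_complex \<Gamma> r)"
proof -
  let ?h = "\<lambda>x. r `` {x}"
  have "vertices (quotient_complex \<Gamma> r) = ?h ` vertices \<Gamma>"
    by (auto simp: quotient_complex_def)
  moreover have "G \<in> quotient_complex \<Gamma> r" if FG: "F \<in> quotient_complex \<Gamma> r" "G \<subseteq> F" for F G
  proof -
    obtain H where H: "H \<in> \<Gamma>" "F = ?h ` H"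
      using FG(1) by (auto simp: quotient_complex_def)
    then obtain K where "K \<subseteq> H" "G = ?h ` K"
      using FG(2) by (blast elim: subset_imageE)
    then show ?thesis
      using assms H unfolding simplicial_complex_def quotient_complex_def by blast
  qed
  ultimately show ?thesis
    using assms by (simp add: simplicial_complex_def)
qed

text \<open>As \<open>f\<close> is injective on \<open>S\<close> and maps \<open>S\<close> outside
  \<open>S\<close>, chains of steps never reach a third element.\<close>

lemma equivclp_identification:
  assumes "inj_on f S" "f ` S \<inter> S = {}"
  shows "equivclp (\<lambda>a b. a \<in> S \<and> b = f a) x y \<longleftrightarrow> x = y \<or> (x \<in> S \<and> y = f x) \<or> (y \<in> S \<and> x = f y)"
proof
  assume "equivclp (\<lambda>a b. a \<in> S \<and> b = f a) x y"
  then show "x = y \<or> (x \<in> S \<and> y = f x) \<or> (y \<in> S \<and> x = f y)"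
  proof (induction rule: equivclp_induct)
    case (step y z)
    then show ?case
      using assms by (auto simp: inj_on_def)
  qed simp
qed (auto intro: equivclp_sym)

section \<open>The quotient map on vertices, edges and faces\<close>

locale gluing =
  fixes V :: "'v set" and E :: "'v set set" and S1 S2 :: "'v set" and f :: "'v \<Rightarrow> 'v"
  assumes chordal: "chordal_graph V E"
    and S1: "S1 \<in> clique_complex V E" and S2: "S2 \<in> clique_complex V E"
    and disjoint: "S1 \<inter> S2 = {}" and bij: "bij_betw f S1 S2" and card: "card S1 > 1"
    and no_common: "\<And>v s t. v \<in> V \<Longrightarrow> s \<in> S1 \<Longrightarrow> t \<in> S2 \<Longrightarrow> {v, s} \<in> E \<Longrightarrow> {v, t} \<in> E \<Longrightarrow> False"
begin

abbreviation "\<Gamma> \<equiv> clique_complex V E"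
abbreviation "cls x \<equiv> identification \<Gamma> S1 f `` {x}"
abbreviation "\<Delta> \<equiv> quotient_complex \<Gamma> (identification \<Gamma> S1 f)"

text \<open>Reflexive adjacency: the pairs that lie in a common face, at which the partial matrix is
  prescribed.\<close>

definition adj :: "'v \<Rightarrow> 'v \<Rightarrow> bool"
  where "adj x y \<longleftrightarrow> x \<in> V \<and> y \<in> V \<and> (x = y \<or> {x, y} \<in> E)"

lemma adj_sym: "adj x y \<Longrightarrow> adj y x"
  by (auto simp: adj_def insert_commute)

lemma clique_adj: "F \<in> \<Gamma> \<Longrightarrow> x \<in> F \<Longrightarrow> y \<in> F \<Longrightarrow> adj x y"
  by (auto simp: adj_def clique_complex_def)

lemma singleton_clique: "x \<in> V \<Longrightarrow> {x} \<in> \<Gamma>"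
  by (simp add: clique_complex_def)

lemma vertices_clique_complex: "vertices \<Gamma> = V"
  using singleton_clique by (auto simp: clique_complex_def)

lemma simplicial: "simplicial_complex \<Gamma>"
proof -
  have "finite V"
    using chordal by (simp add: chordal_graph_def simple_graph_def)
  moreover have "G \<in> \<Gamma>" if "F \<in> \<Gamma>" "G \<subseteq> F" for F G
    using that unfolding clique_complex_def by blast
  ultimately show ?thesis
    unfolding simplicial_complex_def vertices_clique_complex by blast
qed

lemma f_S2: "s \<in> S1 \<Longrightarrow> f s \<in> S2"
  using bij by (auto simp: bij_betw_def)

lemma S1_V: "s \<in> S1 \<Longrightarrow> s \<in> V" and S2_V: "t \<in> S2 \<Longrightarrow> t \<in> V"
  using S1 S2 by (auto simp: clique_complex_def)

text \<open>An edge from \<open>s\<close> to \<open>t\<close> would make \<open>s\<close> itself a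
  common neighbour, of \<open>t\<close> and of a second vertex of \<open>S1\<close>, which exists
  because \<open>card S1 > 1\<close>.\<close>

lemma no_edge:
  assumes "s \<in> S1" "t \<in> S2"
  shows "\<not> adj s t"
proof
  assume "adj s t"
  then have st: "{s, t} \<in> E"
    using assms disjoint by (auto simp: adj_def)
  have "S1 \<noteq> {s}"
    using card by auto
  then obtain s' where s': "s' \<in> S1" "s' \<noteq> s"
    using assms(1) by blast
  then have "{s, s'} \<in> E"
    using S1 assms(1) by (auto simp: clique_complex_def)
  then show False
    using no_common[OF S1_V[OF assms(1)] s'(1) assms(2)] st by blast
qed

text \<open>Extends \<open>no_common\<close> to reflexive adjacency: the cases \<open>v = s\<close>
  and \<open>v = t\<close> fall under \<open>no_edge\<close>.\<close>

lemma no_common_adj: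
  assumes "s \<in> S1" "t \<in> S2" "adj v s" "adj v t"
  shows False
proof -
  have "v \<noteq> s" "v \<noteq> t"
    using no_edge[OF assms(1,2)] assms(3,4) adj_sym by auto
  then show False
    using no_common[OF _ assms(1,2)] assms(3,4) by (auto simp: adj_def)
qed

lemma cls_eq_iff:
  assumes "x \<in> V" "y \<in> V"
  shows "cls x = cls y \<longleftrightarrow> x = y \<or> (x \<in> S1 \<and> y = f x) \<or> (y \<in> S1 \<and> x = f y)"
proof -
  let ?R = "equivclp (\<lambda>a b. a \<in> S1 \<and> b = f a)"
  have cls: "cls z = {w \<in> V. ?R z w}" if "z \<in> V" for z
    using that by (auto simp: identification_def vertices_clique_complex simp del: Union_iff)
  have "cls x = cls y \<longleftrightarrow> ?R x y"
  proof
    assume "cls x = cls y"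
    then have "y \<in> cls x"
      unfolding cls[OF assms(2)] using assms(2) by (simp add: equivclp_refl)
    then show "?R x y"
      unfolding cls[OF assms(1)] by simp
  next
    assume "?R x y"
    then have "?R x w \<longleftrightarrow> ?R y w" for w
      by (meson equivclp_sym equivclp_trans)
    then show "cls x = cls y"
      unfolding cls[OF assms(1)] cls[OF assms(2)] by simp
  qed
  also have "\<dots> \<longleftrightarrow> x = y \<or> (x \<in> S1 \<and> y = f x) \<or> (y \<in> S1 \<and> x = f y)"
    by (rule equivclp_identification) (use bij disjoint in \<open>auto simp: bij_betw_def\<close>)
  finally show ?thesis .
qed

lemma cls_f: "s \<in> S1 \<Longrightarrow> cls (f s) = cls s"
  using cls_eq_iff[of "f s" s] S1_V S2_V f_S2 by auto

text \<open>Identified vertices \<open>s\<close> and \<open>f s\<close> are never adjacent, so the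
  quotient collapses no face.\<close>

lemma inj_on_cls: "F \<in> \<Gamma> \<Longrightarrow> inj_on cls F"
proof (rule inj_onI)
  fix x y assume F: "F \<in> \<Gamma>" "x \<in> F" "y \<in> F" "cls x = cls y"
  then have "adj x y" "adj y x"
    using clique_adj by auto
  then show "x = y"
    using F(4) cls_eq_iff[of x y] no_edge f_S2 by (auto simp: adj_def)
qed

text \<open>Lifts that differ at one end only would give a common neighbour of some \<open>s\<close>
  and \<open>f s\<close>; lifts whose ends move in opposite directions would give an edge between
  \<open>S1\<close> and \<open>S2\<close>. Hence a matrix descends to the quotient once
  \<open>f\<close> preserves its entries on \<open>S1\<close>.\<close>

lemma edge_lift:
  assumes "adj x y" "adj x' y'" "cls x = cls x'" "cls y = cls y'"
  shows "(x = x' \<and> y = y') \<or> (x \<in> S1 \<and> y \<in> S1 \<and> x' = f x \<and> y' = f y) \<or>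
    (x' \<in> S1 \<and> y' \<in> S1 \<and> x = f x' \<and> y = f y')"
proof -
  have V: "x \<in> V" "y \<in> V" "x' \<in> V" "y' \<in> V"
    using assms by (auto simp: adj_def)
  have x: "x = x' \<or> (x \<in> S1 \<and> x' = f x) \<or> (x' \<in> S1 \<and> x = f x')"
    and y: "y = y' \<or> (y \<in> S1 \<and> y' = f y) \<or> (y' \<in> S1 \<and> y = f y')"
    using assms cls_eq_iff V by auto
  have adj: "adj y x" "adj y' x'"
    using assms adj_sym by auto
  have 1: "\<not> (adj z s \<and> adj z (f s))" if "s \<in> S1" for s z
    using no_common_adj[OF that f_S2[OF that]] by blast
  have 2: "\<not> adj s (f t)" if "s \<in> S1" "t \<in> S1" for s t
    using no_edge[OF that(1) f_S2[OF that(2)]] .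
  from x show ?thesis
  proof (elim disjE conjE)
    assume "x = x'"
    then show ?thesis
      using y assms(1,2) 1[of y x] 1[of y' x] by auto
  next
    assume "x \<in> S1" "x' = f x"
    then show ?thesis
      using y assms(1,2) adj 1[of x y] 2[of x y'] by auto
  next
    assume "x' \<in> S1" "x = f x'"
    then show ?thesis
      using y assms(1,2) adj 1[of x' y] 2[of x' y] by auto
  qed
qed

text \<open>\<open>A\<close> and \<open>B\<close> are the inner products of the Gram vectors with the real and imaginary part of a
  complex eigenvector of the isometry that takes the vectors of \<open>S1\<close> to those of \<open>S2\<close>.\<close>

lemma extreme_form_two_squares:
  assumes q: "spans_extreme_ray \<Delta> (nonneg_forms \<Delta>) q"
  obtains e A B where "e \<ge> 0" "\<And>F x. F \<in> \<Gamma> \<Longrightarrow> x \<in> coord_space (cls ` F) \<Longrightarrow>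
    SR_eval q x = e * ((\<Sum>i\<in>F. A i * x (cls i))\<^sup>2 + (\<Sum>i\<in>F. B i * x (cls i))\<^sup>2)"
proof -
  have simplicial_\<Delta>: "simplicial_complex \<Delta>"
    by (rule simplicial_complex_quotient[OF simplicial])
  have face: "cls ` F \<in> \<Delta>" if "F \<in> \<Gamma>" for F
    using that by (auto simp: quotient_complex_def)
  have face_E: "\<exists>F\<in>\<Gamma>. G = cls ` F" if "G \<in> \<Delta>" for G
    using that by (auto simp: quotient_complex_def)
  have "q \<in> nonneg_forms \<Delta>"
    using q by (simp add: spans_extreme_ray_def)
  then obtain M where M: "\<And>c d. M c d = M d c"
    "\<And>F x. F \<in> \<Delta> \<Longrightarrow> x \<in> coord_space F \<Longrightarrow> SR_eval q x = form F M x"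
    "\<And>F x. F \<in> \<Delta> \<Longrightarrow> form F M x \<ge> 0"
    using nonneg_form_matrix[OF simplicial_\<Delta>] by blast
  define N where "N i j = M (cls i) (cls j)" for i j
  have psd_N: "psd_on F N" if "F \<in> \<Gamma>" for F
    unfolding N_def by (rule psd_on_comp[OF inj_on_cls[OF that] M(3)[OF face[OF that]]])
  have "N i j = N j i" for i j
    unfolding N_def by (rule M(1))
  from chordal_gram_completion_induced[OF chordal this psd_N subset_refl]
  obtain m1 v1 where "\<forall>i\<in>V. \<forall>j\<in>V. i = j \<or> {i, j} \<in> E \<longrightarrow> N i j = dot m1 (v1 i) (v1 j)"
    by blast
  then have v1: "\<forall>i j. adj i j \<longrightarrow> N i j = dot m1 (v1 i) (v1 j)"
    unfolding adj_def by blast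
  \<comment> \<open>Minimal dimension forces the Gram vectors to span; this is used through
    \<open>min\<close> below.\<close>
  define P where "P n \<longleftrightarrow> (\<exists>v. \<forall>i j. adj i j \<longrightarrow> N i j = dot n (v i) (v j))" for n
  define m where "m = (LEAST n. P n)"
  have "P m1"
    unfolding P_def using v1 by (rule exI[of _ v1])
  then have "P m"
    unfolding m_def by (rule LeastI)
  have min: "m \<le> n" if "P n" for n
    unfolding m_def using that by (rule Least_le)
  obtain v where v: "\<And>i j. adj i j \<Longrightarrow> N i j = dot m (v i) (v j)"
    using \<open>P m\<close> unfolding P_def by blast
  define g where "g F x a = (\<Sum>i\<in>F. x (cls i) * v i a)" for F and x :: "'v set \<Rightarrow> real" and a
  have q_eval: "SR_eval q x = dot m (g F x) (g F x)"
    if F: "F \<in> \<Gamma>" and x: "x \<in> coord_space (cls ` F)" for F x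
  proof -
    have "SR_eval q x = form F N (\<lambda>i. x (cls i))"
      unfolding M(2)[OF face[OF F] x] form_image[OF inj_on_cls[OF F]] N_def ..
    also have "\<dots> = form F (\<lambda>i j. dot m (v i) (v j)) (\<lambda>i. x (cls i))"
      by (intro form_cong v clique_adj[OF F])
    finally show ?thesis
      unfolding form_gram g_def .
  qed
  show thesis
  proof (cases m)
    case 0
    \<comment> \<open>In dimension 0 all values are zero, and \<open>e = 0\<close> will do.\<close>
    show thesis
      by (rule that[of 0]) (simp_all add: q_eval 0 dot_def)
  next
    case (Suc m')
    have "dot m (v s) (v t) = dot m (v (f s)) (v (f t))" if "s \<in> S1" "t \<in> S1" for s t
    proof -
      have "dot m (v s) (v t) = N (f s) (f t)"
        unfolding v[OF clique_adj[OF S1 that], symmetric] N_def cls_f[OF that(1)] cls_f[OF that(2)] ..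
      also have "\<dots> = dot m (v (f s)) (v (f t))"
        by (rule v[OF clique_adj[OF S2 f_S2[OF that(1)] f_S2[OF that(2)]]])
      finally show ?thesis .
    qed
    moreover have "finite S1"
      using card card.infinite by fastforce
    ultimately have "\<exists>T. isometry m T \<and> (\<forall>s\<in>S1. \<forall>i<m. T (v s) i = v (f s) i)"
      by (intro isometry_extension)
    then obtain T where T: "isometry m T" "\<And>s i. s \<in> S1 \<Longrightarrow> i < m \<Longrightarrow> T (v s) i = v (f s) i"
      by blast
    have "m > 0"
      using Suc by simp
    obtain a b where ab: "\<exists>i<m. a i \<noteq> 0 \<or> b i \<noteq> 0"
      "\<And>x y. dot m (T x) a * dot m (T y) a + dot m (T x) b * dot m (T y) b
        = dot m x a * dot m y a + dot m x b * dot m y b"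
      using isometry_eigenplane_dot[OF T(1) \<open>m > 0\<close>] by blast
    define A B where "A i = dot m (v i) a" and "B i = dot m (v i) b" for i
    have "dot m (T (v s)) z = dot m (v (f s)) z" if "s \<in> S1" for s z
      using T(2)[OF that] by (intro dot_cong) auto
    then have inv: "A (f s) * A (f t) + B (f s) * B (f t) = A s * A t + B s * B t" if "s \<in> S1" "t \<in> S1" for s t
      using ab(2)[of "v s" "v t"] that by (simp add: A_def B_def)
    \<comment> \<open>By Cauchy-Schwarz the sum of the two squares is at most \<open>D\<close> times
      the given form, hence the scalar \<open>1 / D\<close> in \<open>Z\<close>.\<close>
    define D where "D = dot m a a + dot m b b"
    have "D \<noteq> 0"
      using ab(1) dot_self_nonneg[of m a] dot_self_nonneg[of m b] unfolding D_def
      by (metis add_nonneg_eq_0_iff dot_self_eq_0_iff)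
    then have D: "D > 0"
      using dot_self_nonneg[of m a] dot_self_nonneg[of m b] unfolding D_def by linarith
    define Z where "Z i j = 1 / D * (A i * A j + B i * B j)" for i j
    \<comment> \<open>Descends \<open>Z\<close> to pairs of classes; the choice is consistent by
      \<open>edge_lift\<close> and \<open>inv\<close>. At pairs without an adjacent lift the value
      is arbitrary, but no face contains such a pair.\<close>
    define Y where "Y c d = (SOME y. \<exists>i j. adj i j \<and> c = cls i \<and> d = cls j \<and> y = Z i j)" for c d
    have Y: "Y (cls i) (cls j) = Z i j" if ij: "adj i j" for i j
      unfolding Y_def
    proof (rule some_equality)
      fix y assume "\<exists>i' j'. adj i' j' \<and> cls i = cls i' \<and> cls j = cls j' \<and> y = Z i' j'"
      then obtain i' j' where "adj i' j'" "cls i = cls i'" "cls j = cls j'" and y: "y = Z i' j'"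
        by blast
      from edge_lift[OF ij this(1-3)] show "y = Z i j"
        unfolding y Z_def using inv by auto
    qed (use ij in blast)
    have Y_form: "form (cls ` F) Y x
        = 1 / D * ((\<Sum>i\<in>F. A i * x (cls i))\<^sup>2 + (\<Sum>i\<in>F. B i * x (cls i))\<^sup>2)" if F: "F \<in> \<Gamma>" for F x
    proof -
      have "form (cls ` F) Y x = form F Z (\<lambda>i. x (cls i))"
        unfolding form_image[OF inj_on_cls[OF F]] by (intro form_cong Y clique_adj[OF F])
      then show ?thesis
        unfolding Z_def form_two_squares .
    qed
    have Y_bounds: "0 \<le> form G Y x \<and> form G Y x \<le> SR_eval q x" if G: "G \<in> \<Delta>" and x: "x \<in> coord_space G" for G x
    proof -
      obtain F where F: "F \<in> \<Gamma>" "G = cls ` F"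
        using face_E[OF G] by blast
      have sums: "(\<Sum>i\<in>F. A i * x (cls i)) = dot m (g F x) a" "(\<Sum>i\<in>F. B i * x (cls i)) = dot m (g F x) b"
        unfolding g_def dot_sum A_def B_def by (simp_all add: mult.commute)
      have "(dot m (g F x) a)\<^sup>2 + (dot m (g F x) b)\<^sup>2 \<le> dot m (g F x) (g F x) * D"
        using Cauchy_Schwarz_dot[of m "g F x" a] Cauchy_Schwarz_dot[of m "g F x" b]
        unfolding D_def distrib_left by linarith
      then have "1 / D * ((dot m (g F x) a)\<^sup>2 + (dot m (g F x) b)\<^sup>2) \<le> dot m (g F x) (g F x)"
        using D by (simp add: field_simps)
      then show ?thesis
        using D x unfolding F(2) Y_form[OF F(1)] sums by (simp add: q_eval[OF F(1)])
    qed
    have "\<exists>i\<in>V. A i \<noteq> 0 \<or> B i \<noteq> 0"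
    proof (rule ccontr)
      assume none: "\<not> (\<exists>i\<in>V. A i \<noteq> 0 \<or> B i \<noteq> 0)"
      \<comment> \<open>One of \<open>a\<close> and \<open>b\<close> is nonzero and would be
        orthogonal to all Gram vectors, so one dimension could be saved.\<close>
      obtain d where d: "dot m d d \<noteq> 0" "\<And>i. i \<in> V \<Longrightarrow> dot m (v i) d = 0"
        using none ab(1) dot_self_eq_0_iff[of m a] dot_self_eq_0_iff[of m b] unfolding A_def B_def by metis
      obtain w where w: "\<And>i j. i \<in> V \<Longrightarrow> j \<in> V \<Longrightarrow> dot m' (w i) (w j) = dot (Suc m') (v i) (v j)"
        using gram_reduce_dim[of V m' v d] d Suc by metis
      have "m \<le> m'"
      proof (rule min, unfold P_def, rule exI[of _ w], intro allI impI)
        fix i j assume "adj i j"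
        then show "N i j = dot m' (w i) (w j)"
          using v[of i j] w[of i j] Suc by (simp add: adj_def)
      qed
      then show False
        using Suc by simp
    qed
    then obtain i where i: "i \<in> V" "A i \<noteq> 0 \<or> B i \<noteq> 0"
      by blast
    \<comment> \<open>At this unit vector the form of \<open>Y\<close> has the value
      \<open>((A i)^2 + (B i)^2) / D\<close>.\<close>
    define x0 where "x0 c = (if c = cls i then 1 else 0 :: real)" for c
    have "x0 \<in> coord_space (cls ` {i})"
      by (simp add: coord_space_def x0_def)
    moreover have "form (cls ` {i}) Y x0 > 0"
    proof -
      have "(A i)\<^sup>2 + (B i)\<^sup>2 > 0"
        using i(2) by (simp add: sum_power2_gt_zero_iff)
      then show ?thesis
        unfolding Y_form[OF singleton_clique[OF i(1)]] using D by (simp add: x0_def)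
    qed
    ultimately obtain C where C: "C \<ge> 0" "\<And>F x. F \<in> \<Delta> \<Longrightarrow> x \<in> coord_space F \<Longrightarrow> SR_eval q x = C * form F Y x"
      using extreme_ray_dominated_form[OF simplicial_\<Delta> q Y_bounds face[OF singleton_clique[OF i(1)]]] by blast
    show thesis
    proof (rule that[of "C / D" A B])
      show "C / D \<ge> 0"
        using C(1) D by simp
      show "SR_eval q x = C / D * ((\<Sum>i\<in>F. A i * x (cls i))\<^sup>2 + (\<Sum>i\<in>F. B i * x (cls i))\<^sup>2)"
        if "F \<in> \<Gamma>" "x \<in> coord_space (cls ` F)" for F x
        unfolding C(2)[OF face[OF that(1)] that(2)] Y_form[OF that(1)] by simp
    qed
  qed
qed

lemma extreme_form_locr_le_2:
  assumes q: "spans_extreme_ray \<Delta> (nonneg_forms \<Delta>) q"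
  shows "locr \<Delta> q \<le> 2"
proof -
  obtain e A B where e: "e \<ge> 0" and eval: "\<And>F x. F \<in> \<Gamma> \<Longrightarrow> x \<in> coord_space (cls ` F) \<Longrightarrow>
    SR_eval q x = e * ((\<Sum>i\<in>F. A i * x (cls i))\<^sup>2 + (\<Sum>i\<in>F. B i * x (cls i))\<^sup>2)"
    using extreme_form_two_squares[OF q] by blast
  have rank: "form_rank G (SR_eval q) \<le> 2" if G: "G \<in> \<Delta>" for G
  proof -
    obtain F where F: "F \<in> \<Gamma>" "G = cls ` F"
      using G by (auto simp: quotient_complex_def)
    \<comment> \<open>Each class in \<open>G\<close> has a unique representative in
      \<open>F\<close>. The factor \<open>e\<close> is absorbed as \<open>sqrt e\<close>, and index
      0 selects \<open>A\<close>, index 1 selects \<open>B\<close>.\<close>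
    define a where "a j c = sqrt e * (if j = (0::nat) then A else B) (inv_into F cls c)" for j c
    have "(\<Sum>c\<in>G. a j c * x c) = sqrt e * (\<Sum>i\<in>F. (if j = 0 then A else B) i * x (cls i))" for j x
      unfolding F(2) sum.reindex[OF inj_on_cls[OF F(1)]] sum_distrib_left
      by (intro sum.cong refl) (simp add: a_def inv_into_f_f[OF inj_on_cls[OF F(1)]])
    then have "(\<Sum>c\<in>G. a j c * x c)\<^sup>2 = e * (\<Sum>i\<in>F. (if j = 0 then A else B) i * x (cls i))\<^sup>2" for j x
      using e by (simp add: power_mult_distrib)
    then have "SR_eval q x = (\<Sum>j<2. (\<Sum>c\<in>G. a j c * x c)\<^sup>2)" if "x \<in> coord_space G" for x
      using eval[OF F(1), of x] that F(2) by (simp add: numeral_2_eq_2 distrib_left)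
    then show ?thesis
      by (rule form_rank_le)
  qed
  have "\<Delta> \<subseteq> Pow (vertices \<Delta>)"
    by blast
  then have "finite \<Delta>"
    using simplicial_complex_quotient[OF simplicial] finite_subset unfolding simplicial_complex_def
    by (metis finite_Pow_iff)
  moreover have "\<Delta> \<noteq> {}"
    using S1 by (auto simp: quotient_complex_def)
  ultimately show ?thesis
    unfolding locr_def using rank by simp
qed

end

theorem theorem3p2:
  fixes \<Gamma> :: "'v set set" and S1 S2 :: "'v set" and f :: "'v \<Rightarrow> 'v" and k :: nat
  assumes "simplicial_complex \<Gamma>" and "chordal_complex \<Gamma>"
    and "S1 \<in> \<Gamma>" and "S2 \<in> \<Gamma>" and "S1 \<inter> S2 = {}"
    and "card S1 = k" and "card S2 = k" and "k > 1" and "odd k"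
    and "\<not> (\<exists>v \<in> vertices \<Gamma>. (\<exists>s\<in>S1. {v, s} \<in> edges \<Gamma>) \<and> (\<exists>t\<in>S2. {v, t} \<in> edges \<Gamma>))"
    and "bij_betw f S1 S2"
  shows "elocr (quotient_complex \<Gamma> (identification \<Gamma> S1 f)) \<le> k - 1"
proof -
  obtain V E where VE: "chordal_graph V E" "\<Gamma> = clique_complex V E"
    using assms(2) by (auto simp: chordal_complex_def)
  have edges: "e \<in> edges \<Gamma>" if "e \<in> E" for e
  proof -
    have "e \<subseteq> V" "card e = 2"
      using VE(1) that by (auto simp: chordal_graph_def simple_graph_def)
    moreover from this obtain x y where "e = {x, y}"
      by (auto simp: card_2_iff)
    ultimately show ?thesis
      using that unfolding edges_def VE(2) clique_complex_def by (auto simp: insert_commute)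
  qed
  have "V \<subseteq> vertices \<Gamma>"
    unfolding VE(2) clique_complex_def by blast
  then interpret gluing V E S1 S2 f
    using assms edges VE by unfold_locales blast+
  have "k \<ge> 3"
    using assms(8,9) by presburger
  define X where "X = locr \<Delta> ` {q \<in> nonneg_forms \<Delta> - sos_forms \<Delta>. spans_extreme_ray \<Delta> (nonneg_forms \<Delta>) q}"
  \<comment> \<open>The empty set is treated separately because \<open>cSup_least\<close> needs a
    nonempty one; on \<open>nat\<close> its \<open>Sup\<close> is 0.\<close>
  have "Sup X \<le> 2"
  proof (cases "X = {}")
    case False
    then show ?thesis
      by (rule cSup_least) (auto simp: X_def extreme_form_locr_le_2)
  qed simp
  then have "Sup X \<le> k - 1"
    using \<open>k \<ge> 3\<close> by linarith
  \<comment> \<open>If the quotient is chordal, the value is 0 by definition; otherwise it is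
    \<open>Sup X\<close>.\<close>
  then show ?thesis
    unfolding VE(2) elocr_def X_def by simp
qed

end
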